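(* There is a polynomial time $4$-approximation algorithm for pipelined set cover with OR-precedence constraints that take the form of an inforest.
   Context: Pipelined set cover with OR-precedence constraints: given a finite ground set $V$, nonnegative costs $c_v$ for $v\in V$, a collection $\mathcal{E}$ of subsets (hyperedges) of $V$ with nonnegative weights $w_e$, and a DAG $G=(V,E)$. A linear ordering $\pi$ of $V$ is feasible if every $v$ with a nonempty set of direct predecessors $\{u:(u,v)\in E\}$ appears after at least one of them. The covering cost of $e\in\mathcal{E}$ under $\pi$ is $C(e)=\min_{v\in e}\sum_{u:\pi(u)\le\pi(v)}c_u$ (total cost of all elements up to and including the first element of $e$). The objective is to minimize $\sum_{e\in\mathcal{E}}w_eC(e)$ over feasible orderings. An intree is a (weakly) connected DAG in which each vertex has at most one successor; an inforest is a DAG whose connected components are intrees. A $4$-approximation algorithm returns a feasible ordering with objective at most $4$ times the optimum. *)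

theory Defs
  imports
    "HOL-Computational_Algebra.Polynomial"
    "HOL-Library.Discrete_Functions"
begin

definition dag :: "'v set \<Rightarrow> ('v \<times> 'v) set \<Rightarrow> bool" where
  "dag V E \<longleftrightarrow> finite V \<and> E \<subseteq> V \<times> V \<and> acyclic E"

definition weak_reach :: "'v set \<Rightarrow> ('v \<times> 'v) set \<Rightarrow> ('v \<times> 'v) set" where
  "weak_reach V E = {(u, v). u \<in> V \<and> v \<in> V \<and> (u, v) \<in> (E \<union> E\<inverse>)\<^sup>*}"

definition weakly_connected :: "'v set \<Rightarrow> ('v \<times> 'v) set \<Rightarrow> bool" where
  "weakly_connected V E \<longleftrightarrow> (\<forall>u\<in>V. \<forall>v\<in>V. (u, v) \<in> weak_reach V E)"

definition intree :: "'v set \<Rightarrow> ('v \<times> 'v) set \<Rightarrow> bool" where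
  "intree V E \<longleftrightarrow> dag V E \<and> weakly_connected V E \<and> (\<forall>u\<in>V. card {v. (u, v) \<in> E} \<le> 1)"

definition inforest :: "'v set \<Rightarrow> ('v \<times> 'v) set \<Rightarrow> bool" where
  "inforest V E \<longleftrightarrow> dag V E \<and> (\<forall>K \<in> V // weak_reach V E. intree K (E \<inter> K \<times> K))"

record 'v psc =
  ground :: "'v set"
  elem_cost :: "'v \<Rightarrow> rat"
  hyperedges :: "'v set set"
  weight :: "'v set \<Rightarrow> rat"
  arcs :: "('v \<times> 'v) set"

text \<open>Hyperedges are nonempty because the covering cost is a minimum over the hyperedge.\<close>

definition psc_wf :: "'v psc \<Rightarrow> bool" where
  "psc_wf I \<longleftrightarrow>
     dag (ground I) (arcs I) \<and>
     (\<forall>v\<in>ground I. 0 \<le> elem_cost I v) \<and>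
     hyperedges I \<subseteq> Pow (ground I) - {{}} \<and>
     (\<forall>e\<in>hyperedges I. 0 \<le> weight I e)"

text \<open>A linear ordering is given by its position function, with positions starting at 1.\<close>

definition linear_ordering :: "'v set \<Rightarrow> ('v \<Rightarrow> nat) \<Rightarrow> bool" where
  "linear_ordering V \<pi> \<longleftrightarrow> bij_betw \<pi> V {1..card V}"

definition feasible :: "'v psc \<Rightarrow> ('v \<Rightarrow> nat) \<Rightarrow> bool" where
  "feasible I \<pi> \<longleftrightarrow>
     linear_ordering (ground I) \<pi> \<and>
     (\<forall>v\<in>ground I. {u. (u, v) \<in> arcs I} \<noteq> {} \<longrightarrow> (\<exists>u. (u, v) \<in> arcs I \<and> \<pi> u < \<pi> v))"

definition covering_cost :: "'v psc \<Rightarrow> ('v \<Rightarrow> nat) \<Rightarrow> 'v set \<Rightarrow> rat" where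
  "covering_cost I \<pi> e =
     Min ((\<lambda>v. \<Sum>u \<in> {u \<in> ground I. \<pi> u \<le> \<pi> v}. elem_cost I u) ` e)"

definition objective :: "'v psc \<Rightarrow> ('v \<Rightarrow> nat) \<Rightarrow> rat" where
  "objective I \<pi> = (\<Sum>e\<in>hyperedges I. weight I e * covering_cost I \<pi> e)"

text \<open>
  Although \<open>feasible I\<close> holds of infinitely many functions (which may differ outside the ground
  set), the objective takes finitely many values on them, so the minimum is well defined.
\<close>

definition opt :: "'v psc \<Rightarrow> rat" where
  "opt I = Min (objective I ` {\<pi>. feasible I \<pi>})"

text \<open>
  Programs are those of a structured random access machine with logarithmic cost. The state holds
  arrays (named by numbers, of which a program mentions only finitely many) with cells indexed by
  natural numbers. Every number that is read, written, used as an address or passed to an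
  arithmetic operation is charged its binary length. Hence a run of time \<open>t\<close> touches at most \<open>t\<close>
  cells and only handles numbers of \<open>O(t)\<close> bits, and polynomial time in this model coincides with
  polynomial time on Turing machines.
\<close>

type_synonym state = "nat \<Rightarrow> nat \<Rightarrow> nat"

text \<open>\<open>floor_log 0 = 0\<close>, so the number 0 has size 1.\<close>

definition bit_size :: "nat \<Rightarrow> nat" where
  "bit_size k = Suc (floor_log k)"

datatype exp =
    Const nat
  | Read nat exp
  | Add exp exp
  | Sub exp exp
  | Mul exp exp

fun eval_exp :: "exp \<Rightarrow> state \<Rightarrow> nat" where
  "eval_exp (Const k) s = k"
| "eval_exp (Read a i) s = s a (eval_exp i s)"
| "eval_exp (Add x y) s = eval_exp x s + eval_exp y s"
| "eval_exp (Sub x y) s = eval_exp x s - eval_exp y s"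
| "eval_exp (Mul x y) s = eval_exp x s * eval_exp y s"

fun exp_time :: "exp \<Rightarrow> state \<Rightarrow> nat" where
  "exp_time (Const k) s = bit_size k"
| "exp_time (Read a i) s =
     exp_time i s + bit_size (eval_exp i s) + bit_size (s a (eval_exp i s))"
| "exp_time (Add x y) s =
     exp_time x s + exp_time y s + bit_size (eval_exp x s) + bit_size (eval_exp y s)"
| "exp_time (Sub x y) s =
     exp_time x s + exp_time y s + bit_size (eval_exp x s) + bit_size (eval_exp y s)"
| "exp_time (Mul x y) s =
     exp_time x s + exp_time y s + bit_size (eval_exp x s) + bit_size (eval_exp y s)"

text \<open>
  \<open>Write a i x\<close> stores \<open>x\<close> in cell \<open>i\<close> of array \<open>a\<close>. Conditions are tests for being nonzero;
  since subtraction is truncated, \<open>Sub y x\<close> tests whether \<open>x < y\<close>.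
\<close>

datatype com =
    Skip
  | Write nat exp exp
  | Seq com com
  | Cond exp com com
  | While exp com

text \<open>\<open>runs c s t s'\<close>: started in \<open>s\<close>, the program \<open>c\<close> halts in \<open>s'\<close> after time \<open>t\<close>.\<close>

inductive runs :: "com \<Rightarrow> state \<Rightarrow> nat \<Rightarrow> state \<Rightarrow> bool" where
  runs_Skip: "runs Skip s 1 s"
| runs_Write: "runs (Write a i x) s
     (1 + exp_time i s + exp_time x s + bit_size (eval_exp i s) + bit_size (eval_exp x s))
     (s(a := (s a)(eval_exp i s := eval_exp x s)))"
| runs_Seq: "runs c s t s' \<Longrightarrow> runs d s' t' s'' \<Longrightarrow> runs (Seq c d) s (1 + t + t') s''"
| runs_Cond_True: "eval_exp b s \<noteq> 0 \<Longrightarrow> runs c s t s' \<Longrightarrow>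
     runs (Cond b c d) s (1 + exp_time b s + t) s'"
| runs_Cond_False: "eval_exp b s = 0 \<Longrightarrow> runs d s t s' \<Longrightarrow>
     runs (Cond b c d) s (1 + exp_time b s + t) s'"
| runs_While_True: "eval_exp b s \<noteq> 0 \<Longrightarrow> runs c s t s' \<Longrightarrow> runs (While b c) s' t' s'' \<Longrightarrow>
     runs (While b c) s (1 + exp_time b s + t + t') s''"
| runs_While_False: "eval_exp b s = 0 \<Longrightarrow> runs (While b c) s (1 + exp_time b s) s"

text \<open>The input word occupies an initial segment of array 0; all other cells start as 0.\<close>

definition initial_state :: "nat list \<Rightarrow> state" where
  "initial_state xs = (\<lambda>a i. if a = 0 \<and> i < length xs then xs ! i else 0)"

definition input_size :: "nat list \<Rightarrow> nat" where
  "input_size xs = (\<Sum>x\<leftarrow>xs. bit_size x)"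

text \<open>Array 1 holds the output.\<close>

definition result :: "state \<Rightarrow> nat \<Rightarrow> nat" where
  "result s = s 1"

text \<open>Numerator and denominator of a nonnegative rational in lowest terms.\<close>

definition encode_rat :: "rat \<Rightarrow> nat list" where
  "encode_rat q = [nat (fst (quotient_of q)), nat (snd (quotient_of q))]"

text \<open>
  An instance with ground set \<open>{0..<n}\<close>, its hyperedges being listed as \<open>es\<close>, is encoded by \<open>n\<close>, the
  number of hyperedges, the element costs, the adjacency matrix of the precedence graph row by row,
  and, for each hyperedge, its weight followed by its incidence vector.
\<close>

definition encode_psc :: "nat psc \<Rightarrow> nat set list \<Rightarrow> nat list" where
  "encode_psc I es =
     (let n = card (ground I) in
      [n, length es]
      @ concat (map (\<lambda>v. encode_rat (elem_cost I v)) [0..<n])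
      @ concat (map (\<lambda>u. map (\<lambda>v. of_bool ((u, v) \<in> arcs I)) [0..<n]) [0..<n])
      @ concat (map (\<lambda>e. encode_rat (weight I e) @ map (\<lambda>v. of_bool (v \<in> e)) [0..<n]) es))"

definition encodes :: "nat list \<Rightarrow> nat psc \<Rightarrow> bool" where
  "encodes xs I \<longleftrightarrow>
     ground I = {0..<card (ground I)} \<and>
     (\<exists>es. distinct es \<and> set es = hyperedges I \<and> xs = encode_psc I es)"

definition approximation_algorithm :: "com \<Rightarrow> (nat psc \<Rightarrow> bool) \<Rightarrow> rat \<Rightarrow> bool" where
  "approximation_algorithm P C \<alpha> \<longleftrightarrow>
     (\<forall>I xs. psc_wf I \<and> C I \<and> encodes xs I \<longrightarrow>
        (\<exists>t s. runs P (initial_state xs) t s \<and>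
               feasible I (result s) \<and> objective I (result s) \<le> \<alpha> * opt I))"

definition polynomial_time :: "com \<Rightarrow> (nat psc \<Rightarrow> bool) \<Rightarrow> bool" where
  "polynomial_time P C \<longleftrightarrow>
     (\<exists>p :: nat poly. \<forall>I xs. psc_wf I \<and> C I \<and> encodes xs I \<longrightarrow>
        (\<exists>t s. runs P (initial_state xs) t s \<and> t \<le> poly p (input_size xs)))"

end

theory Submission
  imports Defs "HOL-Library.FuncSet"
begin

text \<open>
  Call a vertex available if it is not placed yet and has no predecessor or one that is placed. The
  algorithm repeatedly takes, among all walks that start in an available vertex and follow the
  unique successors, one that maximises the ratio of newly covered weight to added cost, and appends
  its new vertices. Any set of vertices closed under the precedence constraints splits, outside
  the vertices already placed, into disjoint walks of this kind; since cost is additive and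
  coverage is subadditive, the best walk is at least as dense as any feasible set. This is what the
  histogram argument for min-sum set cover needs: with \<open>R\<close> the uncovered weight before a step that
  costs \<open>d\<close> and covers \<open>\<gamma>\<close>, a feasible set of cost at most \<open>R d / (2 \<gamma>)\<close> covers at most half of \<open>R\<close>,
  so the histogram of the algorithm, halved in both directions, fits below that of any feasible
  ordering.

  The program avoids fractions by multiplying all costs, and all weights, by the product of their
  denominators. The resulting numbers have polynomially many bits, and every loop is run at most
  linearly often, so that the running time is polynomial.
\<close>

section \<open>Greedy orderings against an optimal ordering\<close>

text \<open>The factor 4 is the product of the two halvings: a column of area \<open>R d\<close>
  shrinks to width \<open>\<gamma> / 2\<close> and height \<open>R d / (2 \<gamma>)\<close>. The
  sets to compare with are prefixes of an arbitrary feasible ordering and may spread over many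
  trees, whereas only quadratically many candidates can be inspected. Unique successors bridge this
  gap: a walk is determined by its start and length, and following arcs forward cuts a closed set
  into pieces each of which can be appended on its own. Vanishing costs and gains are the main
  obstacle. Cross-multiplied comparison of densities is not transitive, but a strict improvement
  forces the losing side to have positive cost, and this restores transitivity. A walk with neither
  cost nor gain is never replaced once chosen; it passes every comparison trivially and adds no area
  to the histogram. Termination does not depend on gains, since every chosen walk starts in an
  unplaced vertex. All size estimates go back to one fact: a product of distinct input cells is at
  most 2 to the power of the input size \<open>N\<close>. Sums of at most \<open>N\<close> such
  products give the bound \<open>N * 2 ^ N\<close> on every cell.\<close>

lemma layer_weights:
  fixes T :: "'a::linordered_idom set"
  assumes "finite T" "\<And>x. x \<in> T \<Longrightarrow> 0 < x"
  shows "\<exists>\<delta>. (\<forall>t\<in>insert 0 T. 0 \<le> \<delta> t) \<and>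
    (\<forall>x\<in>insert 0 T. x = (\<Sum>t | t \<in> insert 0 T \<and> t < x. \<delta> t))"
  using assms
proof (induction T rule: finite_linorder_max_induct)
  case empty
  have "{t. t \<in> insert 0 {} \<and> t < (0::'a)} = {}" by auto
  then have "x = (\<Sum>t | t \<in> insert 0 {} \<and> t < x. 0)" if "x \<in> insert (0::'a) {}" for x
    using that by (metis insertE empty_iff sum.empty)
  then show ?case by (intro exI[where x = "\<lambda>_. 0"] conjI ballI) auto
next
  case (insert m T)
  then obtain \<delta> where \<delta>: "\<forall>t\<in>insert 0 T. 0 \<le> \<delta> t"
    "\<And>x. x \<in> insert 0 T \<Longrightarrow> x = (\<Sum>t | t \<in> insert 0 T \<and> t < x. \<delta> t)"
    by (metis insertCI)
  define M where "M = Max (insert 0 T)"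
  have fin: "finite (insert 0 T)" using insert.hyps(1) by simp
  have MT: "M \<in> insert 0 T" unfolding M_def by (rule Max_in) (use fin in auto)
  have Mmax: "x \<le> M" if "x \<in> insert 0 T" for x unfolding M_def using fin that by simp
  have mT: "x < m" if "x \<in> insert 0 T" for x using that insert by auto
  \<comment> \<open>\<open>\<delta> t\<close> is the gap from \<open>t\<close> to the next larger
    element, a discrete form of integrating the indicator of \<open>t < x\<close>. The old maximum
    \<open>M\<close> gets its gap only now; its previous value entered no sum.\<close>
  define \<delta>' where "\<delta>' = \<delta>(M := m - M, m := 0)"
  have old: "x = (\<Sum>t | t \<in> insert 0 (insert m T) \<and> t < x. \<delta>' t)" if "x \<in> insert 0 T" for x
  proof -
    have "{t. t \<in> insert 0 (insert m T) \<and> t < x} = {t. t \<in> insert 0 T \<and> t < x}"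
      using mT[OF that] by auto
    moreover have "(\<Sum>t | t \<in> insert 0 T \<and> t < x. \<delta>' t) = (\<Sum>t | t \<in> insert 0 T \<and> t < x. \<delta> t)"
      by (rule sum.cong) (use Mmax[OF that] mT in \<open>auto simp: \<delta>'_def\<close>)
    ultimately show ?thesis using \<delta>(2)[OF that] by simp
  qed
  have new: "m = (\<Sum>t | t \<in> insert 0 (insert m T) \<and> t < m. \<delta>' t)"
  proof -
    have "{t. t \<in> insert 0 (insert m T) \<and> t < m} = insert M {t. t \<in> insert 0 T \<and> t < M}"
    proof (intro set_eqI iffI)
      fix t assume "t \<in> {t. t \<in> insert 0 (insert m T) \<and> t < m}"
      then have "t \<in> insert 0 T" "t \<le> M" using Mmax by auto
      then show "t \<in> insert M {t. t \<in> insert 0 T \<and> t < M}" by auto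
    qed (use mT MT in auto)
    then have "(\<Sum>t | t \<in> insert 0 (insert m T) \<and> t < m. \<delta>' t) =
      \<delta>' M + (\<Sum>t | t \<in> insert 0 T \<and> t < M. \<delta>' t)"
      using fin by (simp add: sum.insert_if)
    also have "(\<Sum>t | t \<in> insert 0 T \<and> t < M. \<delta>' t) = (\<Sum>t | t \<in> insert 0 T \<and> t < M. \<delta> t)"
      by (rule sum.cong) (use mT in \<open>auto simp: \<delta>'_def\<close>)
    also have "\<dots> = M" using \<delta>(2)[OF MT] by simp
    finally show ?thesis using mT[OF MT] by (simp add: \<delta>'_def)
  qed
  have "x = (\<Sum>t | t \<in> insert 0 (insert m T) \<and> t < x. \<delta>' t)"
    if "x \<in> insert 0 (insert m T)" for x
  proof (cases "x = m")
    case True show ?thesis unfolding True by (rule new)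
  next
    case False
    then have "x \<in> insert 0 T" using that by auto
    then show ?thesis by (rule old)
  qed
  moreover have "0 \<le> \<delta>' t" if "t \<in> insert 0 (insert m T)" for t
    using \<delta>(1) mT[OF MT] that by (auto simp: \<delta>'_def)
  ultimately show ?case
    by (intro exI[where x = \<delta>'] conjI ballI)
qed

lemma sum_by_layers:
  fixes f :: "'i \<Rightarrow> 'a::linordered_idom"
  assumes "finite T" "\<And>x. x \<in> T \<Longrightarrow> x = (\<Sum>t | t \<in> T \<and> t < x. \<delta> t)"
    and "finite C" "\<And>i. i \<in> C \<Longrightarrow> f i \<in> T"
  shows "(\<Sum>i\<in>C. r i * f i) = (\<Sum>t\<in>T. \<delta> t * (\<Sum>i | i \<in> C \<and> t < f i. r i))"
proof -
  have "(\<Sum>i\<in>C. r i * f i) = (\<Sum>i\<in>C. \<Sum>t | t \<in> T \<and> t < f i. \<delta> t * r i)"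
  proof (rule sum.cong)
    fix i assume "i \<in> C"
    then have "f i = (\<Sum>t | t \<in> T \<and> t < f i. \<delta> t)" using assms by blast
    then have "r i * f i = r i * (\<Sum>t | t \<in> T \<and> t < f i. \<delta> t)" by presburger
    then show "r i * f i = (\<Sum>t | t \<in> T \<and> t < f i. \<delta> t * r i)"
      by (simp add: sum_distrib_left mult.commute)
  qed simp
  also have "\<dots> = (\<Sum>t\<in>T. \<Sum>i | i \<in> C \<and> t < f i. \<delta> t * r i)"
    by (rule sum.swap_restrict) (use assms in auto)
  finally show ?thesis by (simp add: sum_distrib_left)
qed

text \<open>The area of a histogram with widths \<open>p\<close> and heights \<open>a\<close> is the
  integral over all levels of the total width exceeding that level, so domination at every level
  gives domination of the areas.\<close>

lemma sum_le_of_tails: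
  fixes a :: "'i \<Rightarrow> 'a::linordered_idom" and b :: "'j \<Rightarrow> 'a"
  assumes fin: "finite A" "finite B"
    and a: "\<And>i. i \<in> A \<Longrightarrow> 0 \<le> a i" and b: "\<And>j. j \<in> B \<Longrightarrow> 0 \<le> b j"
    and tails: "\<And>t. 0 \<le> t \<Longrightarrow> (\<Sum>i | i \<in> A \<and> t < a i. p i) \<le> (\<Sum>j | j \<in> B \<and> t < b j. q j)"
  shows "(\<Sum>i\<in>A. p i * a i) \<le> (\<Sum>j\<in>B. q j * b j)"
proof -
  define T where "T = (a ` A \<union> b ` B) - {0}"
  have T: "finite T" "\<And>x. x \<in> T \<Longrightarrow> 0 < x"
    unfolding T_def using fin a b by (force simp: order.strict_iff_order)+
  define T' where "T' = insert 0 T"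
  obtain \<delta> where \<delta>: "\<forall>t\<in>T'. 0 \<le> \<delta> t" "\<And>x. x \<in> T' \<Longrightarrow> x = (\<Sum>t | t \<in> T' \<and> t < x. \<delta> t)"
    using layer_weights[OF T] unfolding T'_def by metis
  have fin': "finite T'" using T by (simp add: T'_def)
  have T'_nonneg: "0 \<le> t" if "t \<in> T'" for t using that T by (auto simp: T'_def less_imp_le)
  have mem: "a i \<in> T'" if "i \<in> A" for i using that by (auto simp: T'_def T_def)
  have mem': "b j \<in> T'" if "j \<in> B" for j using that by (auto simp: T'_def T_def)
  have "(\<Sum>i\<in>A. p i * a i) = (\<Sum>t\<in>T'. \<delta> t * (\<Sum>i | i \<in> A \<and> t < a i. p i))"
    by (rule sum_by_layers[OF fin' _ fin(1) mem]) (rule \<delta>(2))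
  also have "\<dots> \<le> (\<Sum>t\<in>T'. \<delta> t * (\<Sum>j | j \<in> B \<and> t < b j. q j))"
    by (intro sum_mono mult_left_mono tails) (use \<delta>(1) T'_nonneg in blast)+
  also have "\<dots> = (\<Sum>j\<in>B. q j * b j)"
    by (rule sum_by_layers[OF fin' _ fin(2) mem', symmetric]) (rule \<delta>(2))
  finally show ?thesis .
qed

section \<open>OR-closed sets, coverage and the greedy step\<close>

text \<open>In a DAG these are exactly the sets that can form an initial segment of an ordering
  respecting the OR-constraints: list them topologically.\<close>

definition or_closed :: "'v psc \<Rightarrow> 'v set \<Rightarrow> bool" where
  "or_closed I A \<longleftrightarrow> A \<subseteq> ground I \<and>
     (\<forall>v\<in>A. {u. (u, v) \<in> arcs I} \<noteq> {} \<longrightarrow> (\<exists>u\<in>A. (u, v) \<in> arcs I))"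

definition coverage :: "'v psc \<Rightarrow> 'v set \<Rightarrow> rat" where
  "coverage I A = (\<Sum>e | e \<in> hyperedges I \<and> e \<inter> A \<noteq> {}. weight I e)"

definition total_cost :: "'v psc \<Rightarrow> 'v set \<Rightarrow> rat" where
  "total_cost I A = (\<Sum>v\<in>A. elem_cost I v)"

text \<open>The density comparison is cross-multiplied, since costs may vanish.\<close>

definition greedy_step :: "'v psc \<Rightarrow> 'v set \<Rightarrow> 'v set \<Rightarrow> bool" where
  "greedy_step I S S' \<longleftrightarrow> S \<subseteq> S' \<and> S' \<subseteq> ground I \<and>
     (\<forall>A. or_closed I A \<longrightarrow>
        (coverage I (S \<union> A) - coverage I S) * total_cost I (S' - S)
        \<le> (coverage I S' - coverage I S) * total_cost I (A - S))"

definition uncovered :: "'v psc \<Rightarrow> 'v set \<Rightarrow> rat" where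
  "uncovered I A = (\<Sum>e | e \<in> hyperedges I \<and> e \<inter> A = {}. weight I e)"

context
  fixes I :: "'v psc"
  assumes wf: "psc_wf I"
begin

lemma finite_ground: "finite (ground I)"
  using wf by (simp add: psc_wf_def dag_def)

lemma finite_hyperedges: "finite (hyperedges I)"
  using wf finite_ground by (auto simp: psc_wf_def intro: finite_subset)

lemma elem_cost_nonneg: "v \<in> ground I \<Longrightarrow> 0 \<le> elem_cost I v"
  using wf by (simp add: psc_wf_def)

lemma weight_nonneg: "e \<in> hyperedges I \<Longrightarrow> 0 \<le> weight I e"
  using wf by (simp add: psc_wf_def)

lemma hyperedge_ground: "e \<in> hyperedges I \<Longrightarrow> e \<subseteq> ground I \<and> e \<noteq> {} \<and> finite e"
  using wf finite_ground by (auto simp: psc_wf_def intro: finite_subset)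

lemma arcs_ground: "(u, v) \<in> arcs I \<Longrightarrow> u \<in> ground I \<and> v \<in> ground I"
  using wf by (auto simp: psc_wf_def dag_def)

lemma total_cost_nonneg: "A \<subseteq> ground I \<Longrightarrow> 0 \<le> total_cost I A"
  unfolding total_cost_def by (rule sum_nonneg) (use elem_cost_nonneg in auto)

lemma total_cost_mono: "A \<subseteq> B \<Longrightarrow> B \<subseteq> ground I \<Longrightarrow> total_cost I A \<le> total_cost I B"
  unfolding total_cost_def
  by (rule sum_mono2) (use elem_cost_nonneg finite_ground in \<open>auto intro: finite_subset\<close>)

lemma coverage_plus_uncovered:
  "coverage I A + uncovered I A = (\<Sum>e\<in>hyperedges I. weight I e)"
proof -
  have "hyperedges I = {e. e \<in> hyperedges I \<and> e \<inter> A \<noteq> {}} \<union> {e. e \<in> hyperedges I \<and> e \<inter> A = {}}"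
    by auto
  then show ?thesis
    unfolding coverage_def uncovered_def
    using finite_hyperedges by (subst sum.union_disjoint[symmetric]) auto
qed

lemma coverage_diff: "coverage I B - coverage I A = uncovered I A - uncovered I B"
  using coverage_plus_uncovered[of A] coverage_plus_uncovered[of B] by simp

lemma uncovered_mono: "A \<subseteq> B \<Longrightarrow> uncovered I B \<le> uncovered I A"
  unfolding uncovered_def
  by (rule sum_mono2) (use weight_nonneg finite_hyperedges in auto)

lemma uncovered_ground: "uncovered I (ground I) = 0"
  unfolding uncovered_def using hyperedge_ground by (intro sum.neutral) blast

lemma uncovered_nonneg: "0 \<le> uncovered I A"
  unfolding uncovered_def using weight_nonneg by (auto intro: sum_nonneg)

text \<open>The objective depends only on the restriction to the ground set, so the values of
  feasible orderings already occur in the finite function space \<open>?F\<close>. Without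
  finiteness the \<open>Min\<close> in \<open>opt\<close> could not be used.\<close>

lemma finite_objective_values: "finite (objective I ` {\<pi>. feasible I \<pi>})"
proof -
  let ?V = "ground I"
  let ?F = "PiE ?V (\<lambda>_. {1..card ?V})"
  have "objective I \<pi> \<in> objective I ` ?F" if "feasible I \<pi>" for \<pi>
  proof
    have "bij_betw \<pi> ?V {1..card ?V}" using that by (simp add: feasible_def linear_ordering_def)
    then show "restrict \<pi> ?V \<in> ?F" by (auto simp: bij_betw_def)
    have "covering_cost I \<pi> e = covering_cost I (restrict \<pi> ?V) e" if "e \<in> hyperedges I" for e
    proof -
      have *: "e \<subseteq> ?V" using hyperedge_ground that by blast
      show ?thesis unfolding covering_cost_def
        by (rule arg_cong[of _ _ Min], rule image_cong) (use * in \<open>auto intro!: sum.cong\<close>)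
    qed
    then show "objective I \<pi> = objective I (restrict \<pi> ?V)"
      unfolding objective_def by (auto intro: sum.cong)
  qed
  moreover have "finite ?F" by (rule finite_PiE) (simp_all add: finite_ground)
  ultimately show ?thesis
    by (intro finite_subset[of "objective I ` {\<pi>. feasible I \<pi>}", OF image_subsetI finite_imageI])
      simp_all
qed

lemma opt_attained:
  assumes "feasible I \<pi>"
  obtains \<sigma> where "feasible I \<sigma>" "opt I = objective I \<sigma>"
proof -
  have "opt I \<in> objective I ` {\<pi>. feasible I \<pi>}"
    unfolding opt_def by (rule Min_in) (use finite_objective_values assms in auto)
  then show ?thesis using that by auto
qed

text \<open>Since costs are nonnegative, completion times are monotone in the position; hence what
  is completed by time \<open>t\<close> is an initial segment, and its cost is governed by the
  completion time of its last vertex.\<close>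

lemma completed_prefix:
  fixes t :: rat
  defines "A \<equiv> \<lambda>\<sigma>. {v \<in> ground I. (\<Sum>u \<in> {u \<in> ground I. \<sigma> u \<le> \<sigma> v}. elem_cost I u) \<le> t}"
  assumes \<sigma>: "feasible I \<sigma>" and t: "0 \<le> t"
  shows "or_closed I (A \<sigma>)" "total_cost I (A \<sigma>) \<le> t"
proof -
  let ?C = "\<lambda>v. \<Sum>u \<in> {u \<in> ground I. \<sigma> u \<le> \<sigma> v}. elem_cost I u"
  have mono: "?C u \<le> ?C v" if "\<sigma> u \<le> \<sigma> v" for u v
    by (rule sum_mono2) (use that finite_ground elem_cost_nonneg in auto)
  show "or_closed I (A \<sigma>)"
    unfolding or_closed_def
  proof (intro conjI ballI impI)
    fix v assume v: "v \<in> A \<sigma>" and "{u. (u, v) \<in> arcs I} \<noteq> {}"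
    then obtain u where u: "(u, v) \<in> arcs I" "\<sigma> u < \<sigma> v"
      using \<sigma> unfolding feasible_def A_def by auto
    then have "u \<in> A \<sigma>" using mono[of u v] v arcs_ground[of u v] unfolding A_def by auto
    with u show "\<exists>u\<in>A \<sigma>. (u, v) \<in> arcs I" by auto
  qed (auto simp: A_def)
  show "total_cost I (A \<sigma>) \<le> t"
  proof (cases "A \<sigma> = {}")
    case True then show ?thesis using t by (simp add: total_cost_def)
  next
    case False
    have fin: "finite (A \<sigma>)" using finite_ground by (auto simp: A_def)
    have "Max (\<sigma> ` A \<sigma>) \<in> \<sigma> ` A \<sigma>" by (rule Max_in) (use fin False in auto)
    then obtain v where v: "v \<in> A \<sigma>" "\<sigma> v = Max (\<sigma> ` A \<sigma>)" by auto
    then have "\<sigma> u \<le> \<sigma> v" if "u \<in> A \<sigma>" for u using fin that by simp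
    then have "A \<sigma> \<subseteq> {u \<in> ground I. \<sigma> u \<le> \<sigma> v}" by (auto simp: A_def)
    then have "total_cost I (A \<sigma>) \<le> ?C v"
      using total_cost_mono[of "A \<sigma>" "{u \<in> ground I. \<sigma> u \<le> \<sigma> v}"] by (simp add: total_cost_def)
    also have "\<dots> \<le> t" using v by (simp add: A_def)
    finally show ?thesis .
  qed
qed

text \<open>If no element of an edge is completed by time \<open>t\<close>, then all of them finish
  later, and so does their minimum. This turns a tail of the histogram of \<open>\<sigma>\<close>
  into uncovered weight, the quantity that the greedy comparison speaks about.\<close>

lemma uncovered_completed_prefix:
  "uncovered I {v \<in> ground I. (\<Sum>u \<in> {u \<in> ground I. \<sigma> u \<le> \<sigma> v}. elem_cost I u) \<le> t}
   \<le> (\<Sum>e | e \<in> hyperedges I \<and> t < covering_cost I \<sigma> e. weight I e)"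
  unfolding uncovered_def
proof (rule sum_mono2)
  show "{e \<in> hyperedges I. e \<inter> {v \<in> ground I. (\<Sum>u \<in> {u \<in> ground I. \<sigma> u \<le> \<sigma> v}. elem_cost I u) \<le> t} = {}}
    \<subseteq> {e \<in> hyperedges I. t < covering_cost I \<sigma> e}"
    unfolding covering_cost_def using hyperedge_ground by (force simp: Min_gr_iff)
qed (use finite_hyperedges weight_nonneg in auto)

lemma covering_cost_nonneg: "e \<in> hyperedges I \<Longrightarrow> 0 \<le> covering_cost I \<sigma> e"
  unfolding covering_cost_def using hyperedge_ground[of e]
  by (auto intro!: sum_nonneg elem_cost_nonneg)

section \<open>The histogram of a greedy chain\<close>

context
  fixes K :: nat and Sq :: "nat \<Rightarrow> 'v set"
  assumes start: "Sq 0 = {}" and stop: "Sq K = ground I"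
    and greedy_steps: "\<And>i. i < K \<Longrightarrow> greedy_step I (Sq i) (Sq (Suc i))"
begin

lemma chain_ground: "i \<le> K \<Longrightarrow> Sq i \<subseteq> ground I"
  using start greedy_steps[of "i - 1"] by (cases i) (auto simp: greedy_step_def)

lemma chain_mono: "i \<le> j \<Longrightarrow> j \<le> K \<Longrightarrow> Sq i \<subseteq> Sq j"
proof (induction j rule: dec_induct)
  case (step j)
  then show ?case using greedy_steps[of j] by (auto simp: greedy_step_def)
qed auto

lemma total_cost_chain: "j \<le> K \<Longrightarrow> total_cost I (Sq j) = (\<Sum>i<j. total_cost I (Sq (Suc i) - Sq i))"
proof (induction j)
  case 0 then show ?case by (simp add: start total_cost_def)
next
  case (Suc j)
  have "Sq j \<subseteq> Sq (Suc j)" "finite (Sq (Suc j))"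
    using chain_mono[of j "Suc j"] chain_ground[of "Suc j"] Suc.prems finite_ground
    by (auto intro: finite_subset)
  then have "total_cost I (Sq (Suc j)) = total_cost I (Sq j) + total_cost I (Sq (Suc j) - Sq j)"
    unfolding total_cost_def by (metis add.commute sum.subset_diff)
  with Suc show ?case by simp
qed

text \<open>Each edge is charged the full cost of every step before which it is uncovered. The
  charges add up to the cost of the first set of the chain that meets the edge, which bounds its
  covering cost because that set is an initial segment of \<open>\<pi>\<close>. Summing by steps
  instead of by edges gives the right-hand side.\<close>

lemma objective_le_histogram:
  assumes prefix: "\<And>i u v. i \<le> K \<Longrightarrow> v \<in> Sq i \<Longrightarrow> u \<in> ground I \<Longrightarrow> \<pi> u \<le> \<pi> v \<Longrightarrow> u \<in> Sq i"
  shows "objective I \<pi> \<le> (\<Sum>i<K. uncovered I (Sq i) * total_cost I (Sq (Suc i) - Sq i))"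
proof -
  let ?d = "\<lambda>i. total_cost I (Sq (Suc i) - Sq i)"
  have edge: "covering_cost I \<pi> e \<le> (\<Sum>i | i \<in> {..<K} \<and> e \<inter> Sq i = {}. ?d i)"
    if e: "e \<in> hyperedges I" for e
  proof -
    define l where "l = (LEAST i. e \<inter> Sq i \<noteq> {})"
    have eK: "e \<inter> Sq K \<noteq> {}" using hyperedge_ground[OF e] stop by auto
    then have l: "e \<inter> Sq l \<noteq> {}" "l \<le> K"
      unfolding l_def by (rule LeastI[where P = "\<lambda>i. e \<inter> Sq i \<noteq> {}"], intro Least_le)
    have below: "e \<inter> Sq i = {}" if "i < l" for i using that not_less_Least unfolding l_def by blast
    have "{i. i \<in> {..<K} \<and> e \<inter> Sq i = {}} = {..<l}"
    proof (intro set_eqI iffI)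
      fix i assume i: "i \<in> {i. i \<in> {..<K} \<and> e \<inter> Sq i = {}}"
      then show "i \<in> {..<l}" using l chain_mono[of l i] by (cases "l \<le> i") auto
    qed (use below l in auto)
    then have rhs: "(\<Sum>i | i \<in> {..<K} \<and> e \<inter> Sq i = {}. ?d i) = total_cost I (Sq l)"
      using total_cost_chain l by simp
    obtain v where v: "v \<in> e" "v \<in> Sq l" using l by auto
    have "covering_cost I \<pi> e \<le> total_cost I {u \<in> ground I. \<pi> u \<le> \<pi> v}"
      unfolding covering_cost_def total_cost_def
      by (rule Min_le) (use v hyperedge_ground[OF e] in auto)
    also have "\<dots> \<le> total_cost I (Sq l)"
      by (rule total_cost_mono) (use prefix[of l v] v l chain_ground[of l] in auto)
    finally show ?thesis unfolding rhs .
  qed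
  have "objective I \<pi> \<le> (\<Sum>e\<in>hyperedges I. weight I e * (\<Sum>i | i \<in> {..<K} \<and> e \<inter> Sq i = {}. ?d i))"
    unfolding objective_def by (intro sum_mono mult_left_mono edge weight_nonneg)
  also have "\<dots> = (\<Sum>e\<in>hyperedges I. \<Sum>i | i \<in> {..<K} \<and> e \<inter> Sq i = {}. weight I e * ?d i)"
    by (simp add: sum_distrib_left)
  also have "\<dots> = (\<Sum>i<K. \<Sum>e | e \<in> hyperedges I \<and> e \<inter> Sq i = {}. weight I e * ?d i)"
    by (rule sum.swap_restrict) (use finite_hyperedges in auto)
  finally show ?thesis by (simp add: uncovered_def sum_distrib_right)
qed

lemma histogram_le_4_objective:
  assumes \<sigma>: "feasible I \<sigma>"
  shows "(\<Sum>i<K. uncovered I (Sq i) * total_cost I (Sq (Suc i) - Sq i)) \<le> 4 * objective I \<sigma>"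
proof -
  define R where "R i = uncovered I (Sq i)" for i
  define d where "d i = total_cost I (Sq (Suc i) - Sq i)" for i
  define \<gamma> where "\<gamma> i = R i - R (Suc i)" for i
  define a where "a i = R i * d i / (2 * \<gamma> i)" for i
  have greedy: "(uncovered I (Sq i) - uncovered I (Sq i \<union> A)) * d i \<le> \<gamma> i * total_cost I (A - Sq i)"
    if "i < K" "or_closed I A" for i A
    using greedy_steps[OF that(1)] that(2) unfolding greedy_step_def coverage_diff R_def \<gamma>_def d_def by blast
  have \<gamma>: "0 \<le> \<gamma> i" if "i < K" for i
    using uncovered_mono[OF chain_mono[of i "Suc i"]] that by (simp add: \<gamma>_def R_def)
  have d: "0 \<le> d i" if "i < K" for i
    unfolding d_def by (rule total_cost_nonneg) (use chain_ground[of "Suc i"] that in auto)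
  have R: "0 \<le> R i" for i by (simp add: R_def uncovered_nonneg)
  have ground_closed: "or_closed I (ground I)"
    using arcs_ground by (auto simp: or_closed_def)
  \<comment> \<open>For \<open>\<gamma> i = 0\<close> the division makes \<open>a i\<close> equal to
    0. Comparing the step with the whole ground set, which leaves nothing uncovered, then gives
    \<open>R i * d i \<le> 0\<close>, so the tile still has the right area.\<close>
  have tile: "R i * d i = 4 * (\<gamma> i / 2 * a i)" if "i < K" for i
  proof (cases "\<gamma> i = 0")
    case True
    have "Sq i \<union> ground I = ground I" using chain_ground[of i] that by auto
    then have "R i * d i \<le> 0"
      using greedy[OF that ground_closed] True by (simp add: uncovered_ground R_def)
    then have "R i * d i = 0" using R[of i] d[OF that] by (intro order_antisym mult_nonneg_nonneg)
    then show ?thesis using True by simp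
  qed (simp add: a_def)
  have "(\<Sum>i<K. \<gamma> i / 2 * a i) \<le> (\<Sum>e\<in>hyperedges I. weight I e * covering_cost I \<sigma> e)"
  proof (rule sum_le_of_tails)
    fix t :: rat assume t: "0 \<le> t"
    let ?L = "{i. i \<in> {..<K} \<and> t < a i}"
    let ?rhs = "\<Sum>e | e \<in> hyperedges I \<and> t < covering_cost I \<sigma> e. weight I e"
    show "(\<Sum>i\<in>?L. \<gamma> i / 2) \<le> ?rhs"
    proof (cases "?L = {}")
      case True
      have "0 \<le> ?rhs" by (rule sum_nonneg) (simp add: weight_nonneg)
      then show ?thesis unfolding True by simp
    next
      case False
      \<comment> \<open>The heights need not be monotone in \<open>i\<close>. It is enough to take
        the first column exceeding level \<open>t\<close> and to count all later ones: their widths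
        telescope to \<open>R j / 2\<close>, as nothing is uncovered at the end.\<close>
      define j where "j = Min ?L"
      have j: "j \<in> ?L" unfolding j_def by (rule Min_in) (use False in auto)
      then have jK: "j < K" "t < a j" by auto
      have "j \<le> i" if "i \<in> ?L" for i unfolding j_def using that by (intro Min_le) auto
      then have "(\<Sum>i\<in>?L. \<gamma> i / 2) \<le> (\<Sum>i\<in>{j..<K}. \<gamma> i / 2)"
        by (intro sum_mono2) (use \<gamma> in auto)
      also have "\<dots> = R j / 2"
      proof -
        have "(\<Sum>i\<in>{j..<K}. \<gamma> i) = R j - R K"
          using sum_Suc_diff'[of j K "\<lambda>i. - R i"] jK by (simp add: \<gamma>_def)
        then show ?thesis
          by (simp add: sum_divide_distrib[symmetric] R_def stop uncovered_ground)
      qed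
      also have "R j / 2 \<le> ?rhs"
      proof -
        \<comment> \<open>\<open>A\<close> is what \<open>\<sigma>\<close> has completed by time
          \<open>t\<close>. Its cost is below \<open>a j\<close>, and \<open>a j\<close> is the
          budget at which the density of step \<open>j\<close> buys half of \<open>R j\<close>; the
          other half is therefore still uncovered by \<open>A\<close>.\<close>
        define A where "A = {v \<in> ground I. (\<Sum>u \<in> {u \<in> ground I. \<sigma> u \<le> \<sigma> v}. elem_cost I u) \<le> t}"
        have A: "or_closed I A" "total_cost I A \<le> t"
          using completed_prefix[OF \<sigma> t] by (simp_all add: A_def)
        \<comment> \<open>\<open>a j > t \<ge> 0\<close> excludes both a zero numerator and the
          default value of division by zero.\<close>
        have pos: "0 < \<gamma> j" "0 < d j"
          using jK t \<gamma>[of j] d[of j] by (auto simp: a_def order.strict_iff_order)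
        have "(R j - uncovered I (Sq j \<union> A)) * d j \<le> \<gamma> j * total_cost I (A - Sq j)"
          using greedy[OF jK(1) A(1)] by (simp add: R_def)
        also have "\<dots> \<le> \<gamma> j * total_cost I A"
          by (intro mult_left_mono total_cost_mono) (use A pos in \<open>auto simp: or_closed_def\<close>)
        also have "\<dots> \<le> \<gamma> j * a j" by (intro mult_left_mono) (use A jK pos in auto)
        also have "\<dots> = R j / 2 * d j" using pos by (simp add: a_def)
        finally have "R j - uncovered I (Sq j \<union> A) \<le> R j / 2" using pos by simp
        then have "R j / 2 \<le> uncovered I (Sq j \<union> A)" by simp
        also have "\<dots> \<le> uncovered I A" by (rule uncovered_mono) auto
        also have "\<dots> \<le> ?rhs" unfolding A_def by (rule uncovered_completed_prefix)
        finally show ?thesis .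
      qed
      finally show ?thesis .
    qed
  next
    fix i assume "i \<in> {..<K}"
    then show "0 \<le> a i" using R[of i] d[of i] \<gamma>[of i] by (simp add: a_def)
  qed (use finite_hyperedges covering_cost_nonneg in auto)
  moreover have "(\<Sum>i<K. R i * d i) = 4 * (\<Sum>i<K. \<gamma> i / 2 * a i)"
    unfolding sum_distrib_left by (intro sum.cong refl tile) auto
  ultimately show ?thesis unfolding objective_def R_def d_def by simp
qed

end

end

section \<open>Walks in an inforest\<close>

text \<open>Sinks are fixed points, so iteration is total; a walk whose length runs past the end of
  its tree merely repeats the last vertex and does not grow as a set.\<close>

definition next_vertex :: "'v psc \<Rightarrow> 'v \<Rightarrow> 'v" where
  "next_vertex I u = (if \<exists>v. (u, v) \<in> arcs I then SOME v. (u, v) \<in> arcs I else u)"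

definition walk :: "'v psc \<Rightarrow> 'v \<Rightarrow> nat \<Rightarrow> 'v set" where
  "walk I u l = (\<lambda>i. (next_vertex I ^^ i) u) ` {..<l}"

definition available :: "'v psc \<Rightarrow> 'v set \<Rightarrow> 'v \<Rightarrow> bool" where
  "available I S u \<longleftrightarrow> u \<in> ground I \<and> u \<notin> S \<and>
     ((\<forall>w. (w, u) \<notin> arcs I) \<or> (\<exists>w\<in>S. (w, u) \<in> arcs I))"

text \<open>The degree bound is given only inside each weak component, but both successors of
  \<open>u\<close> share the component of \<open>u\<close>. Finiteness is needed to read
  \<open>card \<le> 1\<close> as uniqueness, since \<open>card\<close> is 0 on infinite
  sets.\<close>

lemma inforest_unique_successor:
  assumes F: "inforest V E" and E: "(u, v) \<in> E" "(u, w) \<in> E"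
  shows "v = w"
proof -
  have V: "finite V" "E \<subseteq> V \<times> V" using F by (auto simp: inforest_def dag_def)
  let ?K = "weak_reach V E `` {u}"
  have u: "u \<in> V" "v \<in> V" "w \<in> V" using V E by auto
  have "?K \<in> V // weak_reach V E" using u by (simp add: quotientI)
  then have "intree ?K (E \<inter> ?K \<times> ?K)" using F by (simp add: inforest_def)
  moreover have K: "u \<in> ?K" "v \<in> ?K" "w \<in> ?K"
    using u E by (auto simp: weak_reach_def)
  ultimately have card: "card {v. (u, v) \<in> E \<inter> ?K \<times> ?K} \<le> 1" by (simp add: intree_def)
  have "finite {v. (u, v) \<in> E \<inter> ?K \<times> ?K}"
    using V by (auto intro: finite_subset[of _ V])
  moreover have "v \<in> {v. (u, v) \<in> E \<inter> ?K \<times> ?K}" "w \<in> {v. (u, v) \<in> E \<inter> ?K \<times> ?K}"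
    using E K by auto
  ultimately show "v = w" using card card_le_Suc0_iff_eq by (metis One_nat_def)
qed

text \<open>As soon as one iterate repeats, no later one is new; so the first \<open>k\<close>
  iterates are distinct or already form the whole orbit. Hence no walk longer than the number of
  vertices has to be tried.\<close>

lemma orbit_within_card:
  assumes V: "finite V" "u \<in> V" and f: "\<And>x. x \<in> V \<Longrightarrow> f x \<in> V"
  shows "(f ^^ i) u \<in> (\<lambda>i. (f ^^ i) u) ` {..<card V}"
proof -
  let ?Q = "\<lambda>k. (\<lambda>i. (f ^^ i) u) ` {..<k}"
  have inV: "(f ^^ i) u \<in> V" for i by (induction i) (use V f in auto)
  have stable: "(f ^^ i) u \<in> ?Q k" if "(f ^^ k) u \<in> ?Q k" for i k
  proof (induction i)
    case 0
    then show ?case using that by (cases k) (auto intro!: image_eqI[where x = 0])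
  next
    case (Suc i)
    then obtain j where j: "j < k" "(f ^^ i) u = (f ^^ j) u" by auto
    then have "(f ^^ Suc i) u = (f ^^ Suc j) u" by simp
    then show ?case using that j by (cases "Suc j = k") (auto intro!: image_eqI[where x = "Suc j"])
  qed
  have "card (?Q k) = k \<or> (\<forall>i. (f ^^ i) u \<in> ?Q k)" for k
  proof (induction k)
    case (Suc k)
    show ?case
    proof (cases "(f ^^ k) u \<in> ?Q k")
      case True
      then have "\<forall>i. (f ^^ i) u \<in> ?Q k" using stable by blast
      then show ?thesis by (auto simp: lessThan_Suc)
    next
      case False
      then show ?thesis using Suc by (auto simp: lessThan_Suc)
    qed
  qed simp
  moreover have "?Q (card V) = V" if "card (?Q (card V)) = card V"
    using that inV V by (intro card_subset_eq) auto
  ultimately show ?thesis using inV by metis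
qed

lemma next_vertex_outside: "(\<And>v. (u, v) \<notin> arcs I) \<Longrightarrow> next_vertex I u = u"
  by (simp add: next_vertex_def)

context
  fixes I :: "'v psc"
  assumes wf: "psc_wf I" and forest: "inforest (ground I) (arcs I)"
begin

lemma next_vertex_arc: "(u, v) \<in> arcs I \<Longrightarrow> next_vertex I u = v"
  unfolding next_vertex_def using inforest_unique_successor[OF forest]
  by (metis (mono_tags, lifting) someI)

lemma next_vertex_ground: "u \<in> ground I \<Longrightarrow> next_vertex I u \<in> ground I"
  by (metis arcs_ground[OF wf] next_vertex_arc next_vertex_outside)

lemma walk_ground: "u \<in> ground I \<Longrightarrow> walk I u l \<subseteq> ground I"
proof -
  assume u: "u \<in> ground I"
  have "(next_vertex I ^^ i) u \<in> ground I" for i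
    by (induction i) (use u next_vertex_ground in auto)
  then show ?thesis by (auto simp: walk_def)
qed

lemma exists_available:
  assumes B: "B \<subseteq> ground I" "B \<noteq> {}"
    and closed: "\<And>v. v \<in> B \<Longrightarrow> available I S v \<or> (\<exists>u\<in>B. (u, v) \<in> arcs I)"
  shows "\<exists>u\<in>B. available I S u"
proof -
  have "wf (arcs I)"
    using wf finite_ground[OF wf] by (intro finite_acyclic_wf)
      (auto simp: psc_wf_def dag_def intro: finite_subset)
  then obtain v where "v \<in> B" "\<And>u. (u, v) \<in> arcs I \<Longrightarrow> u \<notin> B"
    using B(2) by (metis wfE_min')
  then show ?thesis using closed by blast
qed

lemma coverage_marginal:
  "coverage I (S \<union> A) - coverage I S
   = (\<Sum>e | e \<in> hyperedges I \<and> e \<inter> S = {} \<and> e \<inter> A \<noteq> {}. weight I e)"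
proof -
  have "{e. e \<in> hyperedges I \<and> e \<inter> (S \<union> A) \<noteq> {}} = {e. e \<in> hyperedges I \<and> e \<inter> S \<noteq> {}} \<union>
    {e. e \<in> hyperedges I \<and> e \<inter> S = {} \<and> e \<inter> A \<noteq> {}}" by auto
  then show ?thesis
    unfolding coverage_def using finite_hyperedges[OF wf]
    by (simp add: sum.union_disjoint disjoint_iff)
qed

lemma coverage_marginal_subadditive:
  "coverage I (S \<union> (A \<union> B)) - coverage I S
   \<le> (coverage I (S \<union> A) - coverage I S) + (coverage I (S \<union> B) - coverage I S)"
proof -
  let ?M = "\<lambda>A. {e. e \<in> hyperedges I \<and> e \<inter> S = {} \<and> e \<inter> A \<noteq> {}}"
  have eq: "?M (A \<union> B) = ?M A \<union> ?M B" by auto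
  have "0 \<le> (\<Sum>e\<in>?M A \<inter> ?M B. weight I e)"
    by (rule sum_nonneg) (use weight_nonneg[OF wf] in auto)
  then show ?thesis
    unfolding coverage_marginal eq using finite_hyperedges[OF wf] by (subst sum_Un) auto
qed

text \<open>
  A residually closed set splits into disjoint walks, because every vertex has at most one
  successor: the walk starting in an available vertex is followed as long as it stays in the set
  and does not meet another available vertex, and what remains is again residually closed.
\<close>

lemma coverage_density_le:
  assumes B: "B \<subseteq> ground I - S"
    and closed: "\<And>v. v \<in> B \<Longrightarrow> available I S v \<or> (\<exists>u\<in>B. (u, v) \<in> arcs I)"
    and walks: "\<And>u l. available I S u \<Longrightarrow> 0 < l \<Longrightarrow> l \<le> card (ground I) \<Longrightarrow>
      (coverage I (S \<union> walk I u l) - coverage I S) * c \<le> g * total_cost I (walk I u l - S)"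
    and c: "0 \<le> c"
  shows "(coverage I (S \<union> B) - coverage I S) * c \<le> g * total_cost I B"
  using B closed
proof (induction "card B" arbitrary: B rule: less_induct)
  case less
  show ?case
  proof (cases "B = {}")
    case True
    then show ?thesis by (simp add: total_cost_def)
  next
    case False
    have finV: "finite (ground I)" by (rule finite_ground[OF wf])
    have finB: "finite B" using less.prems(1) finV by (auto intro: finite_subset)
    obtain u where u: "u \<in> B" "available I S u"
      using exists_available[of B S] less.prems False by blast
    then have uV: "u \<in> ground I" by (simp add: available_def)
    define pt where "pt i = (next_vertex I ^^ i) u" for i
    \<comment> \<open>Index 0 is exempt: the start is itself available. Stopping at any other
      available vertex leaves that vertex behind as a possible start of a later walk.\<close>
    define good where "good i \<longleftrightarrow> (\<forall>j. 0 < j \<and> j \<le> i \<longrightarrow> pt j \<in> B \<and> \<not> available I S (pt j))" for i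
    define P where "P = pt ` {i. good i}"
    have good0: "good 0" by (simp add: good_def)
    have uP: "u \<in> P" unfolding P_def by (rule image_eqI[of _ _ 0]) (simp_all add: pt_def good0)
    have PB: "P \<subseteq> B"
    proof
      fix x assume "x \<in> P"
      then obtain i where i: "good i" "x = pt i" by (auto simp: P_def)
      then show "x \<in> B" using u by (cases "i = 0") (auto simp: good_def pt_def)
    qed
    \<comment> \<open>If some iterate fails, the least failing index is the length. Otherwise the
      walk never leaves the set, for instance because it rests in a sink, and as many iterates as
      there are vertices exhaust it.\<close>
    obtain l where l: "0 < l" "l \<le> card (ground I)" "P = walk I u l"
    proof (cases "\<exists>i\<le>card (ground I). \<not> good i")
      case True
      define l where "l = (LEAST i. \<not> good i)"
      have "\<not> good l" unfolding l_def using True by (metis LeastI)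
      moreover have "l \<le> card (ground I)"
        unfolding l_def using True by (metis Least_le order_trans)
      moreover have "good i" if "i < l" for i using that not_less_Least unfolding l_def by blast
      ultimately have "{i. good i} = {..<l}" "0 < l" "l \<le> card (ground I)"
        using good0 by (auto simp: good_def intro: gr0I)
      then show ?thesis using that[of l] by (simp add: P_def walk_def pt_def[abs_def])
    next
      case False
      have "P \<subseteq> walk I u (card (ground I))"
        unfolding P_def pt_def walk_def
        using orbit_within_card[where f = "next_vertex I", OF finV uV] next_vertex_ground by blast
      moreover have "walk I u (card (ground I)) \<subseteq> P"
        using False by (auto simp: P_def pt_def walk_def)
      moreover have "0 < card (ground I)" using finV uV card_gt_0_iff by blast
      ultimately show ?thesis using that[of "card (ground I)"] by auto
    qed
    define B' where "B' = B - P"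
    have closed': "available I S v \<or> (\<exists>w\<in>B'. (w, v) \<in> arcs I)" if v: "v \<in> B'" for v
    proof (rule ccontr)
      assume *: "\<not> ?thesis"
      then obtain w where w: "w \<in> B" "(w, v) \<in> arcs I" using less.prems(2)[of v] v by (auto simp: B'_def)
      with * obtain i where i: "good i" "w = pt i" by (auto simp: B'_def P_def)
      have "pt (Suc i) = v" using next_vertex_arc[OF w(2)] i by (simp add: pt_def)
      then have "good (Suc i)" using i * v by (auto simp: good_def B'_def le_Suc_eq)
      then show False using v \<open>pt (Suc i) = v\<close> by (auto simp: B'_def P_def)
    qed
    have "card B' < card B"
      unfolding B'_def by (rule psubset_card_mono) (use finB u uP in auto)
    then have IH: "(coverage I (S \<union> B') - coverage I S) * c \<le> g * total_cost I B'"
      by (rule less.hyps) (use less.prems(1) closed' in \<open>auto simp: B'_def\<close>)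
    have "walk I u l - S = P" using l(3) PB less.prems(1) by auto
    then have W: "(coverage I (S \<union> P) - coverage I S) * c \<le> g * total_cost I P"
      using walks[OF u(2) l(1,2)] l(3) by simp
    have B: "B = P \<union> B'" using PB by (auto simp: B'_def)
    have "(coverage I (S \<union> B) - coverage I S) * c \<le>
      ((coverage I (S \<union> P) - coverage I S) + (coverage I (S \<union> B') - coverage I S)) * c"
      unfolding B by (intro mult_right_mono coverage_marginal_subadditive c)
    also have "\<dots> \<le> g * (total_cost I P + total_cost I B')"
      using IH W by (simp add: algebra_simps)
    also have "total_cost I P + total_cost I B' = total_cost I B"
      unfolding total_cost_def B'_def using PB finB by (metis add.commute sum.subset_diff)
    finally show ?thesis .
  qed
qed

text \<open>Testing against walks suffices: if a vertex of \<open>A - S\<close> has no predecessor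
  in \<open>A - S\<close>, OR-closedness of \<open>A\<close> leaves it either without predecessors
  or with one in \<open>S\<close>, so it is available, and \<open>A - S\<close> decomposes into
  walks.\<close>

lemma greedy_step_walk:
  assumes S: "S \<subseteq> ground I" and u: "u \<in> ground I"
    and best: "\<And>v k. available I S v \<Longrightarrow> 0 < k \<Longrightarrow> k \<le> card (ground I) \<Longrightarrow>
      (coverage I (S \<union> walk I v k) - coverage I S) * total_cost I (walk I u l - S)
      \<le> (coverage I (S \<union> walk I u l) - coverage I S) * total_cost I (walk I v k - S)"
  shows "greedy_step I S (S \<union> walk I u l)"
  unfolding greedy_step_def
proof (intro conjI allI impI)
  show "S \<union> walk I u l \<subseteq> ground I" using S walk_ground[OF u] by auto
  fix A assume A: "or_closed I A"
  have "available I S v \<or> (\<exists>u\<in>A - S. (u, v) \<in> arcs I)" if v: "v \<in> A - S" for v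
    using A v unfolding or_closed_def available_def by blast
  moreover have "0 \<le> total_cost I (walk I u l - S)"
    by (rule total_cost_nonneg[OF wf]) (use walk_ground[OF u] in auto)
  moreover have "A - S \<subseteq> ground I - S" using A by (auto simp: or_closed_def)
  ultimately have "(coverage I (S \<union> (A - S)) - coverage I S) * total_cost I (walk I u l - S)
    \<le> (coverage I (S \<union> walk I u l) - coverage I S) * total_cost I (A - S)"
    using best by (intro coverage_density_le) auto
  moreover have "S \<union> walk I u l - S = walk I u l - S" "S \<union> (A - S) = S \<union> A" by auto
  ultimately show "(coverage I (S \<union> A) - coverage I S) * total_cost I (S \<union> walk I u l - S)
    \<le> (coverage I (S \<union> walk I u l) - coverage I S) * total_cost I (A - S)" by simp
qed auto

text \<open>The complement of \<open>S\<close> is residually closed, since every predecessor lies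
  either in it or in \<open>S\<close>. Hence no round is left without a candidate.\<close>

lemma exists_available_outside:
  assumes "S \<subset> ground I"
  shows "\<exists>u. available I S u"
proof -
  have "\<exists>u\<in>ground I - S. available I S u"
    by (rule exists_available) (use assms arcs_ground[OF wf] in \<open>auto simp: available_def; blast\<close>)+
  then show ?thesis by blast
qed

end

section \<open>Orderings that follow a greedy chain\<close>

definition partial_ordering :: "'v psc \<Rightarrow> 'v set \<Rightarrow> ('v \<Rightarrow> nat) \<Rightarrow> bool" where
  "partial_ordering I A \<pi> \<longleftrightarrow> A \<subseteq> ground I \<and> bij_betw \<pi> A {1..card A} \<and>
     (\<forall>v\<in>A. {u. (u, v) \<in> arcs I} \<noteq> {} \<longrightarrow> (\<exists>u\<in>A. (u, v) \<in> arcs I \<and> \<pi> u < \<pi> v))"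

text \<open>This serves as the invariant of the main loop. The memory keeps only positions, so the
  chain of sets that produced them is recorded existentially, each set being an initial segment of
  the ordering.\<close>

definition greedy_ordering :: "'v psc \<Rightarrow> 'v set \<Rightarrow> ('v \<Rightarrow> nat) \<Rightarrow> bool" where
  "greedy_ordering I A \<pi> \<longleftrightarrow> partial_ordering I A \<pi> \<and>
     (\<exists>K Sq. Sq 0 = {} \<and> Sq K = A \<and> (\<forall>i<K. greedy_step I (Sq i) (Sq (Suc i))) \<and>
        (\<forall>i\<le>K. \<forall>v\<in>Sq i. \<forall>u\<in>A. \<pi> u \<le> \<pi> v \<longrightarrow> u \<in> Sq i))"

lemma greedy_ordering_empty: "greedy_ordering I {} \<pi>"
  unfolding greedy_ordering_def partial_ordering_def
  by (auto simp: bij_betw_def intro!: exI[of _ 0] exI[of _ "\<lambda>_. {}"])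

lemma partial_ordering_snoc:
  assumes \<pi>: "partial_ordering I A \<pi>" and fin: "finite A" and x: "x \<in> ground I" "x \<notin> A"
    and pred: "{u. (u, x) \<in> arcs I} \<noteq> {} \<Longrightarrow> \<exists>u\<in>A. (u, x) \<in> arcs I"
  shows "partial_ordering I (insert x A) (\<pi>(x := Suc (card A)))"
  unfolding partial_ordering_def
proof (intro conjI ballI impI)
  have bij: "bij_betw \<pi> A {1..card A}" using \<pi> by (simp add: partial_ordering_def)
  have "bij_betw (\<pi>(x := Suc (card A))) A {1..card A}"
    using bij x by (subst bij_betw_cong[where g = \<pi>]) auto
  then have "bij_betw (\<pi>(x := Suc (card A))) (A \<union> {x}) ({1..card A} \<union> {Suc (card A)})"
    by (rule bij_betw_combine) auto
  moreover have "{1..card A} \<union> {Suc (card A)} = {1..card (insert x A)}"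
    using fin x by auto
  ultimately show "bij_betw (\<pi>(x := Suc (card A))) (insert x A) {1..card (insert x A)}" by simp
  fix v assume v: "v \<in> insert x A" "{u. (u, v) \<in> arcs I} \<noteq> {}"
  show "\<exists>u\<in>insert x A. (u, v) \<in> arcs I \<and> (\<pi>(x := Suc (card A))) u < (\<pi>(x := Suc (card A))) v"
  proof (cases "v = x")
    case True
    then obtain u where u: "u \<in> A" "(u, x) \<in> arcs I" using pred v by auto
    then have "\<pi> u \<le> card A" using bij by (auto simp: bij_betw_def)
    then show ?thesis using u True x by (intro bexI[of _ u]) auto
  next
    case False
    then obtain u where "u \<in> A" "(u, v) \<in> arcs I" "\<pi> u < \<pi> v"
      using \<pi> v unfolding partial_ordering_def by blast
    then show ?thesis using False x by (intro bexI[of _ u]) auto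
  qed
qed (use \<pi> x in \<open>auto simp: partial_ordering_def\<close>)

context
  fixes I :: "'v psc"
  assumes wf: "psc_wf I"
begin

text \<open>The old vertices occupy exactly the positions up to \<open>card S\<close>, so by
  injectivity every new vertex comes after them and the earlier sets of the chain remain initial
  segments.\<close>

lemma greedy_ordering_extend:
  assumes \<pi>: "greedy_ordering I S \<pi>" and step: "greedy_step I S A"
    and \<pi>': "partial_ordering I A \<pi>'" and same: "\<And>v. v \<in> S \<Longrightarrow> \<pi>' v = \<pi> v"
  shows "greedy_ordering I A \<pi>'"
proof -
  obtain K Sq where Sq: "Sq 0 = {}" "Sq K = S" "\<And>i. i < K \<Longrightarrow> greedy_step I (Sq i) (Sq (Suc i))"
    and prefix: "\<And>i u v. i \<le> K \<Longrightarrow> v \<in> Sq i \<Longrightarrow> u \<in> S \<Longrightarrow> \<pi> u \<le> \<pi> v \<Longrightarrow> u \<in> Sq i"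
    using \<pi> unfolding greedy_ordering_def by metis
  have SA: "S \<subseteq> A" using step by (simp add: greedy_step_def)
  have mono: "Sq i \<subseteq> S" if "i \<le> K" for i
    using that
  proof (induction i rule: inc_induct)
    case (step i)
    then show ?case using Sq(3)[of i] by (auto simp: greedy_step_def)
  qed (simp add: Sq)
  have img: "\<pi>' ` S = {1..card S}"
    using \<pi> same by (simp add: greedy_ordering_def partial_ordering_def bij_betw_def cong: image_cong)
  have inj: "inj_on \<pi>' A" "\<pi>' ` A \<subseteq> {1..}"
    using \<pi>' by (auto simp: partial_ordering_def bij_betw_def)
  have late: "u \<in> S" if "u \<in> A" "v \<in> S" "\<pi>' u \<le> \<pi>' v" for u v
  proof -
    have "\<pi>' v \<in> {1..card S}" unfolding img[symmetric] using that(2) by (rule imageI)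
    moreover have "\<pi>' u \<in> {1..}" using inj(2) that(1) by (rule subsetD[OF _ imageI])
    ultimately have "\<pi>' u \<in> {1..card S}" using that(3) by simp
    then obtain w where "w \<in> S" "\<pi>' w = \<pi>' u" using img by (metis imageE)
    then show ?thesis using inj_onD[OF inj(1), of w u] that SA by auto
  qed
  let ?Sq = "Sq(Suc K := A)"
  have "\<forall>i\<le>Suc K. \<forall>v\<in>?Sq i. \<forall>u\<in>A. \<pi>' u \<le> \<pi>' v \<longrightarrow> u \<in> ?Sq i"
  proof (intro allI ballI impI)
    fix i u v assume *: "i \<le> Suc K" "v \<in> ?Sq i" "u \<in> A" "\<pi>' u \<le> \<pi>' v"
    show "u \<in> ?Sq i"
    proof (cases "i = Suc K")
      case False
      then have i: "i \<le> K" "v \<in> Sq i" "v \<in> S" using * mono[of i] by auto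
      then have "u \<in> S" using late * by blast
      then show ?thesis using prefix[OF i(1,2)] same i * by simp
    qed (use * in simp)
  qed
  moreover have "\<forall>i<Suc K. greedy_step I (?Sq i) (?Sq (Suc i))"
    using Sq step by (auto simp: less_Suc_eq)
  moreover have "?Sq 0 = {}" "?Sq (Suc K) = A" using Sq by auto
  ultimately show ?thesis using \<pi>' unfolding greedy_ordering_def by blast
qed

lemma greedy_ordering_4_approx:
  assumes "greedy_ordering I (ground I) \<pi>"
  shows "feasible I \<pi>" "objective I \<pi> \<le> 4 * opt I"
proof -
  show f: "feasible I \<pi>"
    using assms by (auto simp: greedy_ordering_def partial_ordering_def feasible_def linear_ordering_def)
  obtain K Sq where Sq: "Sq 0 = {}" "Sq K = ground I" "\<And>i. i < K \<Longrightarrow> greedy_step I (Sq i) (Sq (Suc i))"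
    and prefix: "\<And>i u v. i \<le> K \<Longrightarrow> v \<in> Sq i \<Longrightarrow> u \<in> ground I \<Longrightarrow> \<pi> u \<le> \<pi> v \<Longrightarrow> u \<in> Sq i"
    using assms unfolding greedy_ordering_def by metis
  obtain \<sigma> where \<sigma>: "feasible I \<sigma>" "opt I = objective I \<sigma>" using opt_attained[OF wf f] .
  have "objective I \<pi> \<le> (\<Sum>i<K. uncovered I (Sq i) * total_cost I (Sq (Suc i) - Sq i))"
    by (rule objective_le_histogram[where Sq = Sq, OF wf Sq]) (assumption | rule prefix)+
  also have "\<dots> \<le> 4 * objective I \<sigma>"
    by (rule histogram_le_4_objective[where Sq = Sq, OF wf Sq \<sigma>(1)])
  finally show "objective I \<pi> \<le> 4 * opt I" by (simp add: \<sigma>(2))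
qed

end

section \<open>Total correctness with time bounds\<close>

text \<open>If all cells are at most \<open>X\<close>, with \<open>X \<ge> 2\<close>, then
  \<open>X ^ exp_degree e\<close> bounds the value of \<open>e\<close>: a constant \<open>k\<close>
  is below \<open>2 ^ Suc k\<close>, and positive powers of \<open>X\<close> are at least 2, so that
  their sums are bounded by their products. All bit lengths are thus multiples of
  \<open>bit_size X\<close> by constants depending only on the expression.\<close>

fun exp_degree :: "exp \<Rightarrow> nat" where
  "exp_degree (Const k) = Suc k"
| "exp_degree (Read a i) = Suc (exp_degree i)"
| "exp_degree (Add x y) = exp_degree x + exp_degree y"
| "exp_degree (Sub x y) = exp_degree x + exp_degree y"
| "exp_degree (Mul x y) = exp_degree x + exp_degree y"

fun exp_bound :: "exp \<Rightarrow> nat" where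
  "exp_bound (Const k) = Suc k"
| "exp_bound (Read a i) = exp_bound i + exp_degree i + 1"
| "exp_bound (Add x y) = exp_bound x + exp_bound y + exp_degree x + exp_degree y"
| "exp_bound (Sub x y) = exp_bound x + exp_bound y + exp_degree x + exp_degree y"
| "exp_bound (Mul x y) = exp_bound x + exp_bound y + exp_degree x + exp_degree y"

definition cells_le :: "nat \<Rightarrow> state \<Rightarrow> bool" where
  "cells_le X s \<longleftrightarrow> (\<forall>a i. s a i \<le> X)"

lemma eval_Read_le: "cells_le X s \<Longrightarrow> eval_exp (Read a i) s \<le> X"
  by (simp add: cells_le_def)

lemma exp_degree_pos: "0 < exp_degree e"
  by (induction e) auto

lemma bit_size_mono: "x \<le> y \<Longrightarrow> bit_size x \<le> bit_size y"
  by (simp add: bit_size_def floor_log_le_iff)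

lemma bit_size_pos: "0 < bit_size x"
  by (simp add: bit_size_def)

lemma less_two_power_bit_size: "x < 2 ^ bit_size x"
  using floor_log_exp2_gt[of x] by (cases "x = 0") (auto simp: bit_size_def)

lemma bit_size_le: "x < 2 ^ k \<Longrightarrow> 0 < k \<Longrightarrow> bit_size x \<le> k"
proof (cases "x = 0")
  case False
  assume "x < 2 ^ k"
  moreover have "2 ^ floor_log x \<le> x" using floor_log_exp2_le[of x] False by simp
  ultimately have "(2::nat) ^ floor_log x < 2 ^ k" by (rule le_less_trans[rotated])
  then have "floor_log x < k" by (rule power_less_imp_less_exp[rotated]) simp
  then show ?thesis by (simp add: bit_size_def)
qed (simp add: bit_size_def)

lemma bit_size_power_le:
  assumes "0 < k"
  shows "bit_size (X ^ k) \<le> k * bit_size X"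
proof (rule bit_size_le)
  have "X ^ k < (2 ^ bit_size X) ^ k"
    by (rule power_strict_mono) (use less_two_power_bit_size assms in auto)
  then show "X ^ k < 2 ^ (k * bit_size X)" by (simp add: power_mult[symmetric] mult.commute)
qed (use assms bit_size_pos in simp)

lemma add_le_mult_nat: "2 \<le> x \<Longrightarrow> 2 \<le> y \<Longrightarrow> x + y \<le> x * (y::nat)"
proof -
  assume "2 \<le> x" "2 \<le> y"
  then obtain a b where "x = a + 2" "y = b + 2" by (metis add.commute le_Suc_ex)
  then show ?thesis by (simp add: algebra_simps)
qed

lemma eval_exp_le:
  assumes X: "2 \<le> X" and s: "cells_le X s"
  shows "eval_exp e s \<le> X ^ exp_degree e"
proof (induction e)
  case (Const k)
  have "k < 2 ^ Suc k" using less_exp[of "Suc k"] by linarith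
  also have "(2::nat) ^ Suc k \<le> X ^ Suc k" by (rule power_mono) (use X in auto)
  finally show ?case by simp
next
  case (Read a i)
  have "s a (eval_exp i s) \<le> X ^ 1" using s by (simp add: cells_le_def)
  also have "\<dots> \<le> X ^ Suc (exp_degree i)" by (rule power_increasing) (use X in auto)
  finally show ?case by simp
next
  case (Add x y)
  have "2 \<le> X ^ exp_degree z" for z
    using power_increasing[of 1 "exp_degree z" X] X exp_degree_pos[of z] by simp
  from add_le_mult_nat[OF this this] Add show ?case by (simp add: power_add) (meson add_mono order_trans)
next
  case (Sub x y)
  have "eval_exp x s - eval_exp y s \<le> X ^ exp_degree x" using Sub by simp
  also have "\<dots> \<le> X ^ (exp_degree x + exp_degree y)" by (rule power_increasing) (use X in auto)
  finally show ?case by simp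
next
  case (Mul x y)
  then show ?case by (simp add: power_add mult_mono)
qed

lemma bit_size_eval_exp_le:
  assumes "2 \<le> X" "cells_le X s"
  shows "bit_size (eval_exp e s) \<le> exp_degree e * bit_size X"
  using bit_size_mono[OF eval_exp_le[OF assms]] bit_size_power_le[OF exp_degree_pos] order_trans
  by blast

lemma exp_time_le:
  assumes X: "2 \<le> X" "cells_le X s"
  shows "exp_time e s \<le> exp_bound e * bit_size X"
proof (induction e)
  case (Const k)
  show ?case using bit_size_eval_exp_le[OF X, of "Const k"] by simp
next
  case (Read a i)
  have "bit_size (s a (eval_exp i s)) \<le> bit_size X"
    using X by (intro bit_size_mono) (simp add: cells_le_def)
  then show ?case
    using Read bit_size_eval_exp_le[OF X, of i] by (simp add: algebra_simps)
qed (use bit_size_eval_exp_le[OF X] in \<open>simp_all add: algebra_simps add_mono\<close>)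

text \<open>
  Time, in units of the size of the largest cell content, provided that no loop iterates more than
  \<open>N\<close> times.
\<close>

fun com_bound :: "nat \<Rightarrow> com \<Rightarrow> nat" where
  "com_bound N Skip = 1"
| "com_bound N (Write a i x) = 1 + exp_bound i + exp_bound x + exp_degree i + exp_degree x"
| "com_bound N (Seq c d) = 1 + com_bound N c + com_bound N d"
| "com_bound N (Cond b c d) = 1 + exp_bound b + com_bound N c + com_bound N d"
| "com_bound N (While b c) = Suc N * (1 + exp_bound b + com_bound N c)"

text \<open>
  Total correctness with a time bound, relative to cell contents staying below \<open>X\<close>; this
  invariant is part of the predicate, so that a proof only has to bound the values being written.
\<close>

definition wp :: "nat \<Rightarrow> nat \<Rightarrow> com \<Rightarrow> (state \<Rightarrow> bool) \<Rightarrow> state \<Rightarrow> bool" where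
  "wp N X c Q s \<longleftrightarrow> (cells_le X s \<longrightarrow>
     (\<exists>t s'. runs c s t s' \<and> t \<le> com_bound N c * bit_size X \<and> cells_le X s' \<and> Q s'))"

fun modified :: "com \<Rightarrow> nat set" where
  "modified Skip = {}"
| "modified (Write a i x) = {a}"
| "modified (Seq c d) = modified c \<union> modified d"
| "modified (Cond b c d) = modified c \<union> modified d"
| "modified (While b c) = modified c"

lemma runs_unmodified: "runs c s t s' \<Longrightarrow> a \<notin> modified c \<Longrightarrow> s' a = s a"
  by (induction rule: runs.induct) auto

lemma wp_mono: "wp N X c Q s \<Longrightarrow> (\<And>s'. cells_le X s' \<Longrightarrow> Q s' \<Longrightarrow> R s') \<Longrightarrow> wp N X c R s"
  unfolding wp_def by blast

text \<open>Specifications mention only what a program computes; what it leaves alone is read off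
  the syntax and added here.\<close>

lemma wp_frame:
  "wp N X c Q s \<Longrightarrow> wp N X c (\<lambda>s'. Q s' \<and> (\<forall>a. a \<notin> modified c \<longrightarrow> s' a = s a)) s"
  unfolding wp_def using runs_unmodified by blast

lemma wp_cells_le: "(cells_le X s \<Longrightarrow> wp N X c Q s) \<Longrightarrow> wp N X c Q s"
  unfolding wp_def by blast

lemma wp_Skip: "Q s \<Longrightarrow> wp N X Skip Q s"
  unfolding wp_def using runs_Skip[of s] bit_size_pos[of X]
  by (intro impI exI[of _ 1] exI[of _ s]) (auto simp: Suc_le_eq)

lemma wp_Write:
  assumes X: "2 \<le> X" and le: "cells_le X s \<Longrightarrow> eval_exp x s \<le> X"
    and Q: "Q (s(a := (s a)(eval_exp i s := eval_exp x s)))"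
  shows "wp N X (Write a i x) Q s"
  unfolding wp_def
proof
  assume s: "cells_le X s"
  let ?t = "1 + exp_time i s + exp_time x s + bit_size (eval_exp i s) + bit_size (eval_exp x s)"
  have "?t \<le> bit_size X + exp_bound i * bit_size X + exp_bound x * bit_size X
      + exp_degree i * bit_size X + exp_degree x * bit_size X"
    using bit_size_pos[of X]
    by (intro add_mono exp_time_le[OF X s] bit_size_eval_exp_le[OF X s]) simp
  also have "\<dots> = com_bound N (Write a i x) * bit_size X" by (simp add: algebra_simps)
  finally have "?t \<le> com_bound N (Write a i x) * bit_size X" .
  moreover have "cells_le X (s(a := (s a)(eval_exp i s := eval_exp x s)))"
    using s le by (simp add: cells_le_def)
  ultimately show "\<exists>t s'. runs (Write a i x) s t s' \<and> t \<le> com_bound N (Write a i x) * bit_size X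
    \<and> cells_le X s' \<and> Q s'"
    using runs_Write Q by blast
qed

lemma wp_Seq:
  assumes "wp N X c (wp N X d Q) s"
  shows "wp N X (Seq c d) Q s"
  unfolding wp_def
proof
  assume "cells_le X s"
  with assms obtain t s' where 1: "runs c s t s'" "t \<le> com_bound N c * bit_size X" "cells_le X s'"
    "wp N X d Q s'" unfolding wp_def by blast
  then obtain t' s'' where 2: "runs d s' t' s''" "t' \<le> com_bound N d * bit_size X" "cells_le X s''"
    "Q s''" unfolding wp_def by blast
  have "1 + t + t' \<le> com_bound N (Seq c d) * bit_size X"
    using 1(2) 2(2) bit_size_pos[of X] by (simp add: algebra_simps)
  then show "\<exists>t s'. runs (Seq c d) s t s' \<and> t \<le> com_bound N (Seq c d) * bit_size X
    \<and> cells_le X s' \<and> Q s'"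
    using runs_Seq[OF 1(1) 2(1)] 2 by blast
qed

lemma wp_Cond:
  assumes X: "2 \<le> X"
    and T: "eval_exp b s \<noteq> 0 \<Longrightarrow> wp N X c Q s" and F: "eval_exp b s = 0 \<Longrightarrow> wp N X d Q s"
  shows "wp N X (Cond b c d) Q s"
  unfolding wp_def
proof
  assume s: "cells_le X s"
  have b: "1 + exp_time b s \<le> bit_size X + exp_bound b * bit_size X"
    using exp_time_le[OF X s, of b] bit_size_pos[of X] by linarith
  show "\<exists>t s'. runs (Cond b c d) s t s' \<and> t \<le> com_bound N (Cond b c d) * bit_size X
    \<and> cells_le X s' \<and> Q s'"
  proof (cases "eval_exp b s = 0")
    case True
    then obtain t s' where 1: "runs d s t s'" "t \<le> com_bound N d * bit_size X" "cells_le X s'" "Q s'"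
      using F s unfolding wp_def by blast
    have "1 + exp_time b s + t \<le> com_bound N (Cond b c d) * bit_size X"
      using b 1(2) by (simp add: algebra_simps)
    then show ?thesis using runs_Cond_False[OF True 1(1)] 1 by blast
  next
    case False
    then obtain t s' where 1: "runs c s t s'" "t \<le> com_bound N c * bit_size X" "cells_le X s'" "Q s'"
      using T s unfolding wp_def by blast
    have "1 + exp_time b s + t \<le> com_bound N (Cond b c d) * bit_size X"
      using b 1(2) by (simp add: algebra_simps)
    then show ?thesis using runs_Cond_True[OF False 1(1)] 1 by blast
  qed
qed

text \<open>The variant \<open>f\<close> does double duty: it proves termination and, starting at no
  more than \<open>N\<close>, counts the passes. The additional pass in \<open>Suc N\<close> pays
  for the final failing test.\<close>

lemma wp_While:
  assumes X: "2 \<le> X" and start: "J s" "f s \<le> N"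
    and body: "\<And>s. J s \<Longrightarrow> eval_exp b s \<noteq> 0 \<Longrightarrow> wp N X c (\<lambda>s'. J s' \<and> f s' < f s) s"
    and stop: "\<And>s. J s \<Longrightarrow> eval_exp b s = 0 \<Longrightarrow> Q s"
  shows "wp N X (While b c) Q s"
proof -
  let ?B = "(1 + exp_bound b + com_bound N c) * bit_size X"
  have "\<exists>t s'. runs (While b c) s t s' \<and> t \<le> Suc (f s) * ?B \<and> cells_le X s' \<and> Q s'"
    if "J s" "cells_le X s" for s
    using that
  proof (induction "f s" arbitrary: s rule: less_induct)
    case less
    have b: "1 + exp_time b s \<le> bit_size X + exp_bound b * bit_size X"
      using exp_time_le[OF X less.prems(2), of b] bit_size_pos[of X] by linarith
    show ?case
    proof (cases "eval_exp b s = 0")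
      case True
      have "1 + exp_time b s \<le> Suc (f s) * ?B"
        using b by (simp add: algebra_simps)
      then show ?thesis using runs_While_False[OF True] stop[OF less.prems(1) True] less.prems(2) by blast
    next
      case False
      obtain t s' where 1: "runs c s t s'" "t \<le> com_bound N c * bit_size X" "cells_le X s'"
        "J s'" "f s' < f s"
        using body[OF less.prems(1) False] less.prems(2) unfolding wp_def by blast
      obtain t' s'' where 2: "runs (While b c) s' t' s''" "t' \<le> Suc (f s') * ?B" "cells_le X s''" "Q s''"
        using less.hyps[OF 1(5) 1(4) 1(3)] by blast
      have "Suc (f s') * ?B \<le> f s * ?B" using 1(5) by (intro mult_le_mono1) simp
      then have "1 + exp_time b s + t + t' \<le> ?B + f s * ?B"
        using b 1(2) 2(2) by (simp add: algebra_simps)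
      then have "1 + exp_time b s + t + t' \<le> Suc (f s) * ?B" by simp
      then show ?thesis using runs_While_True[OF False 1(1) 2(1)] 2(3,4) by blast
    qed
  qed
  moreover have "Suc (f s) * ?B \<le> com_bound N (While b c) * bit_size X"
    using start(2) by (simp add: mult_le_mono1 add_mono mult.assoc[symmetric] del: mult_Suc)
  ultimately show ?thesis unfolding wp_def using start(1) order_trans by meson
qed

abbreviation Scalar :: "nat \<Rightarrow> exp" where "Scalar k \<equiv> Read k (Const 0)"
abbreviation Set :: "nat \<Rightarrow> exp \<Rightarrow> com" where "Set k x \<equiv> Write k (Const 0) x"
abbreviation (input) set_cell :: "nat \<Rightarrow> nat \<Rightarrow> nat \<Rightarrow> state \<Rightarrow> state" where
  "set_cell a i x s \<equiv> s(a := (s a)(i := x))"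

definition For :: "nat \<Rightarrow> exp \<Rightarrow> com \<Rightarrow> com" where
  "For k b c = Seq (Set k (Const 0)) (While (Sub b (Scalar k)) (Seq c (Set k (Add (Scalar k) (Const 1)))))"

lemma modified_For [simp]: "modified (For k b c) = insert k (modified c)"
  by (simp add: For_def)

text \<open>The limit \<open>b\<close> is evaluated anew before every pass, so it must have the
  value \<open>H\<close> in all states that differ only in arrays touched by the loop. The invariant
  takes the counter as an explicit argument and is restated after the increment.\<close>

lemma wp_For:
  assumes X: "2 \<le> X" and H: "H \<le> N" "H \<le> X" and start: "J 0 (set_cell k 0 0 s)"
    and bound: "\<And>s'. (\<forall>a. a \<notin> insert k (modified c) \<longrightarrow> s' a = s a) \<Longrightarrow> eval_exp b s' = H"
    and k: "k \<notin> modified c"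
    and body: "\<And>i s'. i < H \<Longrightarrow> J i s' \<Longrightarrow> s' k 0 = i \<Longrightarrow>
       (\<forall>a. a \<notin> insert k (modified c) \<longrightarrow> s' a = s a) \<Longrightarrow> cells_le X s' \<Longrightarrow>
       wp N X c (\<lambda>s''. J (Suc i) (set_cell k 0 (Suc i) s'')) s'"
    and stop: "\<And>s'. J H s' \<Longrightarrow> (\<forall>a. a \<notin> insert k (modified c) \<longrightarrow> s' a = s a) \<Longrightarrow> Q s'"
  shows "wp N X (For k b c) Q s"
  unfolding For_def
proof (intro wp_Seq wp_Write[OF X] wp_While[OF X])
  let ?fr = "\<lambda>s'. \<forall>a. a \<notin> insert k (modified c) \<longrightarrow> s' a = s a"
  let ?J = "\<lambda>s'. s' k 0 \<le> H \<and> J (s' k 0) s' \<and> ?fr s'"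
  let ?f = "\<lambda>s'. H - s' k 0"
  show "?J (s(k := (s k)(eval_exp (Const 0) s := eval_exp (Const 0) s)))" using start by simp
  show "?f (s(k := (s k)(eval_exp (Const 0) s := eval_exp (Const 0) s))) \<le> N" using H by simp
  show "Q s'" if "?J s'" "eval_exp (Sub b (Scalar k)) s' = 0" for s'
  proof (rule stop)
    have "s' k 0 = H" using that bound[of s'] by simp
    then show "J H s'" using that by auto
  qed (use that in auto)
  show "wp N X c (wp N X (Set k (Add (Scalar k) (Const 1))) (\<lambda>s''. ?J s'' \<and> ?f s'' < ?f s')) s'"
    if J: "?J s'" and b: "eval_exp (Sub b (Scalar k)) s' \<noteq> 0" for s'
  proof (rule wp_cells_le)
    assume "cells_le X s'"
    define i where "i = s' k 0"
    have i: "i < H" using b bound[of s'] J by (simp add: i_def)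
    have "wp N X c (\<lambda>s''. J (Suc i) (set_cell k 0 (Suc i) s'')) s'"
      by (rule body) (use i J \<open>cells_le X s'\<close> in \<open>auto simp: i_def\<close>)
    from wp_frame[OF this] show ?thesis
    proof (rule wp_mono)
      fix s''
      assume s'': "J (Suc i) (set_cell k 0 (Suc i) s'') \<and> (\<forall>a. a \<notin> modified c \<longrightarrow> s'' a = s' a)"
      then have "s'' k 0 = i" using k by (simp add: i_def)
      then show "wp N X (Set k (Add (Scalar k) (Const 1))) (\<lambda>s''. ?J s'' \<and> ?f s'' < ?f s') s''"
        using s'' J i H by (intro wp_Write[OF X]) (auto simp: i_def)
    qed
  qed
qed (use X in auto)

section \<open>Polynomial growth of the time bound\<close>

definition poly_bounded :: "(nat \<Rightarrow> nat) \<Rightarrow> bool" where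
  "poly_bounded f \<longleftrightarrow> (\<exists>p :: nat poly. \<forall>x. f x \<le> poly p x)"

lemma poly_bounded_const: "poly_bounded (\<lambda>_. k)"
  unfolding poly_bounded_def by (rule exI[of _ "[:k:]"]) simp

lemma poly_bounded_id: "poly_bounded (\<lambda>x. x)"
  unfolding poly_bounded_def by (rule exI[of _ "[:0, 1:]"]) simp

lemma poly_bounded_add: "poly_bounded f \<Longrightarrow> poly_bounded g \<Longrightarrow> poly_bounded (\<lambda>x. f x + g x)"
  unfolding poly_bounded_def by (metis add_mono poly_add)

lemma poly_bounded_mult: "poly_bounded f \<Longrightarrow> poly_bounded g \<Longrightarrow> poly_bounded (\<lambda>x. f x * g x)"
  unfolding poly_bounded_def by (metis mult_le_mono poly_mult)

text \<open>The program is fixed while \<open>N\<close> varies, and each level of loop nesting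
  contributes one factor linear in \<open>N\<close>.\<close>

lemma poly_bounded_com_bound: "poly_bounded (\<lambda>N. com_bound N c)"
proof (induction c)
  case (While b c)
  have "poly_bounded (\<lambda>N. (1 + N) * (1 + exp_bound b + com_bound N c))"
    by (intro poly_bounded_mult poly_bounded_add poly_bounded_const poly_bounded_id While)
  then show ?case by simp
next
  case (Seq c d)
  have "poly_bounded (\<lambda>N. 1 + com_bound N c + com_bound N d)"
    by (intro poly_bounded_mult poly_bounded_add poly_bounded_const Seq)
  then show ?case by simp
next
  case (Cond b c d)
  have "poly_bounded (\<lambda>N. 1 + exp_bound b + com_bound N c + com_bound N d)"
    by (intro poly_bounded_mult poly_bounded_add poly_bounded_const Cond)
  then show ?case by simp
qed (simp_all add: poly_bounded_const)

section \<open>The program\<close>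

text \<open>A rational occupies two adjacent cells; its numerator is multiplied by the denominators
  of all others, which is its value times the common product. The sum of the two truncated
  differences is the distance of the counters and serves as the test for inequality.\<close>

definition scale_com :: "exp \<Rightarrow> exp \<Rightarrow> exp \<Rightarrow> nat \<Rightarrow> com" where
  "scale_com base stride cnt out =
     For 9 cnt (Seq
       (Write out (Scalar 9) (Read 0 (Add base (Mul stride (Scalar 9)))))
       (For 10 cnt (Cond (Add (Sub (Scalar 9) (Scalar 10)) (Sub (Scalar 10) (Scalar 9)))
          (Write out (Scalar 9) (Mul (Read out (Scalar 9))
             (Read 0 (Add (Add base (Mul stride (Scalar 10))) (Const 1)))))
          Skip)))"

lemma modified_scale_com [simp]: "modified (scale_com base stride cnt out) = {9, 10, out}"
  by (auto simp: scale_com_def)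

text \<open>The size assumption quantifies over all \<open>U\<close> because every partial product
  passes through the output cell and must stay within the bound as well.\<close>

lemma wp_scale_com:
  fixes B D H :: nat
  assumes X: "2 \<le> X" and H: "H \<le> N" "H \<le> X" and out: "out \<notin> {0, 2, 3, 9, 10}"
    and ev: "\<And>s'. s' 2 = s 2 \<Longrightarrow> s' 3 = s 3 \<Longrightarrow>
      eval_exp base s' = B \<and> eval_exp stride s' = D \<and> eval_exp cnt s' = H"
    and le: "\<And>v U. v < H \<Longrightarrow> U \<subseteq> {..<H} - {v} \<Longrightarrow>
      s 0 (B + D * v) * (\<Prod>u\<in>U. s 0 (B + D * u + 1)) \<le> X"
  shows "wp N X (scale_com base stride cnt out) (\<lambda>s'. \<forall>v<H. s' out v =
      s 0 (B + D * v) * (\<Prod>u\<in>{..<H} - {v}. s 0 (B + D * u + 1))) s"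
proof -
  define r where "r v U = s 0 (B + D * v) * (\<Prod>u\<in>U. s 0 (B + D * u + 1))" for v U
  have le': "r v ({..<j} - {v}) \<le> X" if "v < H" "j \<le> H" for v j
    unfolding r_def using that by (intro le) auto
  have out': "out \<noteq> 0" "out \<noteq> 2" "out \<noteq> 3" "out \<noteq> 9" "out \<noteq> 10" using out by auto
  show ?thesis
    unfolding scale_com_def r_def[symmetric]
  proof (rule wp_For[OF X H, where J = "\<lambda>i s'. \<forall>v<i. s' out v = r v ({..<H} - {v})"], goal_cases)
    case (4 i s')
    then have fr: "s' 0 = s 0" "s' 2 = s 2" "s' 3 = s 3" using out' by simp_all
    have J: "\<And>v. v < i \<Longrightarrow> s' out v = r v ({..<H} - {v})" using 4 out' by simp
    note ev' = ev[OF fr(2,3)]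
    show ?case
    proof (intro wp_Seq wp_Write[OF X], goal_cases)
      case 1
      show ?case using le'[of i 0] 4 fr ev' by (simp add: r_def)
    next
      case 2
      let ?s = "s'(out := (s' out)(eval_exp (Scalar 9) s' := eval_exp (Read 0 (Add base (Mul stride (Scalar 9)))) s'))"
      show ?case
      proof (rule wp_For[OF X H, where J = "\<lambda>j s''. (\<forall>v<i. s'' out v = r v ({..<H} - {v})) \<and>
          s'' out i = r i ({..<j} - {i})"], goal_cases)
        case 1
        show ?case using J ev' fr 4 out' by (simp add: r_def)
      next
        case (2 s'')
        then show ?case using ev[of s''] fr out' by simp
      next
        case (4 j s'')
        then have fr': "s'' 0 = s 0" "s'' 2 = s 2" "s'' 3 = s 3" "s'' 9 0 = i" "s'' 10 0 = j"
          using out' fr \<open>s' 9 0 = i\<close> by simp_all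
        note ev'' = ev[OF fr'(2,3)]
        have step: "r i ({..<Suc j} - {i}) = r i ({..<j} - {i}) * s 0 (B + D * j + 1)" if "j \<noteq> i"
        proof -
          have "{..<Suc j} - {i} = insert j ({..<j} - {i})" using that by auto
          then show ?thesis by (simp add: r_def)
        qed
        have skip: "{..<Suc j} - {i} = {..<j} - {i}" if "j = i" using that by auto
        show ?case
        proof (intro wp_Cond[OF X] wp_Write[OF X] wp_Skip, goal_cases)
          case 1
          then have "j \<noteq> i" using fr' by auto
          then show ?case using 4 step le'[of i "Suc j"] fr' ev'' \<open>i < H\<close> by (simp add: add.assoc)
        next
          case 2
          then have "j \<noteq> i" using fr' by auto
          then show ?case using 4 step fr' ev'' out' by (simp add: add.assoc)
        next
          case 3
          then have "j = i" using fr' by auto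
          then show ?case using 4 fr' skip out' by simp
        qed
      next
        case (5 s'')
        then show ?case using out' by (simp add: less_Suc_eq)
      qed (use X H out' in auto)
    qed
  next
    case (2 s')
    then show ?case using ev[of s'] out' by simp
  qed (use X H out' in auto)
qed

text \<open>
  Memory layout. Arrays: 1 positions, 0 for a vertex not yet placed; 4 and 5 scaled costs and
  weights; 6 successors; 7 membership in the set being evaluated. Scalars: 2 and 3 numbers of
  vertices and hyperedges; 8 number of placed vertices; 9 to 12 loop counters; 13 whether the
  current hyperedge is hit; 14 and 15 coverage and cost of the set being evaluated; 16 and 17 the
  same for the placed vertices; 18 to 21 length (0 if there is none yet) and start of the best
  walk, and coverage and cost of its union with the placed vertices; 22 current vertex of a walk;
  23 and 24 whether the vertex in scalar 9 has a predecessor and a placed predecessor.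
\<close>

definition edge_base :: exp where
  "edge_base = Add (Add (Const 2) (Mul (Const 2) (Scalar 2))) (Mul (Scalar 2) (Scalar 2))"

definition edge_stride :: exp where
  "edge_stride = Add (Scalar 2) (Const 2)"

definition arc_cell :: "exp \<Rightarrow> exp \<Rightarrow> exp" where
  "arc_cell u v = Read 0 (Add (Add (Const 2) (Mul (Const 2) (Scalar 2))) (Add (Mul (Scalar 2) u) v))"

definition incidence_cell :: "exp \<Rightarrow> exp \<Rightarrow> exp" where
  "incidence_cell j v = Read 0 (Add (Add edge_base (Mul edge_stride j)) (Add (Const 2) v))"

definition next_com :: com where
  "next_com = For 9 (Scalar 2) (Seq (Write 6 (Scalar 9) (Scalar 9))
     (For 10 (Scalar 2) (Cond (arc_cell (Scalar 9) (Scalar 10)) (Write 6 (Scalar 9) (Scalar 10)) Skip)))"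

definition copy_com :: com where
  "copy_com = For 11 (Scalar 2) (Write 7 (Scalar 11) (Read 1 (Scalar 11)))"

definition eval_com :: com where
  "eval_com =
     Seq (Set 14 (Const 0)) (Seq (Set 15 (Const 0)) (Seq
       (For 11 (Scalar 2)
         (Cond (Read 7 (Scalar 11)) (Set 15 (Add (Scalar 15) (Read 4 (Scalar 11)))) Skip))
       (For 12 (Scalar 3) (Seq (Set 13 (Const 0)) (Seq
         (For 11 (Scalar 2)
           (Cond (Mul (incidence_cell (Scalar 12) (Scalar 11)) (Read 7 (Scalar 11)))
             (Set 13 (Const 1)) Skip))
         (Set 14 (Add (Scalar 14) (Mul (Scalar 13) (Read 5 (Scalar 12))))))))))"

definition avail_com :: com where
  "avail_com =
     Seq (Set 23 (Const 0)) (Seq (Set 24 (Const 0))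
       (For 11 (Scalar 2)
         (Cond (arc_cell (Scalar 11) (Scalar 9))
           (Seq (Set 23 (Const 1)) (Cond (Read 1 (Scalar 11)) (Set 24 (Const 1)) Skip)) Skip)))"

text \<open>Truth values are numbers tested for being nonzero: \<open>Sub (Const 1) x\<close> is
  negation, \<open>Mul\<close> conjunction and \<open>Add\<close> disjunction. Positions start at 1,
  so a nonzero position means that the vertex is placed.\<close>

definition avail_exp :: exp where
  "avail_exp = Mul (Sub (Const 1) (Read 1 (Scalar 9))) (Add (Sub (Const 1) (Scalar 23)) (Scalar 24))"

text \<open>Either no walk has been recorded, or the current one is strictly denser than the
  recorded one. Strictness is what makes replacement compatible with all earlier
  comparisons.\<close>

definition better_exp :: exp where
  "better_exp = Add (Sub (Const 1) (Scalar 18))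
     (Sub (Mul (Sub (Scalar 14) (Scalar 16)) (Sub (Scalar 21) (Scalar 17)))
          (Mul (Sub (Scalar 20) (Scalar 16)) (Sub (Scalar 15) (Scalar 17))))"

definition update_com :: com where
  "update_com = Seq (Set 18 (Add (Scalar 10) (Const 1))) (Seq (Set 19 (Scalar 9))
     (Seq (Set 20 (Scalar 14)) (Set 21 (Scalar 15))))"

definition walk_com :: com where
  "walk_com = Seq copy_com (Seq (Set 22 (Scalar 9))
     (For 10 (Scalar 2) (Seq (Write 7 (Scalar 22) (Const 1)) (Seq eval_com
       (Seq (Cond better_exp update_com Skip) (Set 22 (Read 6 (Scalar 22))))))))"

definition append_com :: com where
  "append_com = Seq (Set 22 (Scalar 19))
     (For 10 (Scalar 18) (Seq
       (Cond (Sub (Const 1) (Read 1 (Scalar 22)))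
         (Seq (Set 8 (Add (Scalar 8) (Const 1))) (Write 1 (Scalar 22) (Scalar 8))) Skip)
       (Set 22 (Read 6 (Scalar 22)))))"

definition round_com :: com where
  "round_com = Seq copy_com (Seq eval_com (Seq (Set 16 (Scalar 14)) (Seq (Set 17 (Scalar 15))
     (Seq (Set 18 (Const 0)) (Seq
       (For 9 (Scalar 2) (Seq avail_com (Cond avail_exp walk_com Skip)))
       append_com)))))"

definition main_com :: com where
  "main_com = Seq (Set 2 (Read 0 (Const 0))) (Seq (Set 3 (Read 0 (Const 1)))
     (Seq (scale_com (Const 2) (Const 2) (Scalar 2) 4)
     (Seq (scale_com edge_base edge_stride (Scalar 3) 5)
     (Seq next_com (While (Sub (Scalar 2) (Scalar 8)) round_com)))))"

lemma modified_main_parts [simp]: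
  "modified next_com = {9, 10, 6}"
  "modified copy_com = {11, 7}"
  "modified eval_com = {11, 12, 13, 14, 15}"
  "modified avail_com = {11, 23, 24}"
  "modified update_com = {18, 19, 20, 21}"
  "modified walk_com = {7, 10, 11, 12, 13, 14, 15, 18, 19, 20, 21, 22}"
  "modified append_com = {1, 8, 10, 22}"
  by (auto simp: next_com_def copy_com_def eval_com_def avail_com_def update_com_def walk_com_def
      append_com_def)

text \<open>Read as \<open>q / d \<le> f / c < f' / c'\<close>. The strict inequality forces
  \<open>c\<close> to be positive, so it can be cancelled; with a weak one, \<open>f = c = 0\<close>
  would compare with everything and break transitivity.\<close>

lemma cross_mult_trans:
  fixes f f' q c c' d :: nat
  assumes "q * c \<le> f * d" "f * c' < f' * c"
  shows "q * c' \<le> f' * d"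
proof -
  have "(q * c') * c \<le> (f * c') * d"
    using mult_le_mono1[OF assms(1), of c'] by (simp add: ac_simps)
  also have "\<dots> \<le> (f' * c) * d" using assms(2) by (intro mult_le_mono1) simp
  finally have "(q * c') * c \<le> (f' * d) * c" by (simp add: ac_simps)
  then show ?thesis using assms(2) by (cases "c = 0") auto
qed

section \<open>The instance held in memory, with integral costs and weights\<close>

text \<open>Only the contents of the cells matter to the program, not how the input word was built.
  \<open>Y\<close> bounds products of distinct input cells, hence each scaled cost or weight;
  \<open>X\<close> bounds all cells and leaves room for sums of up to \<open>N\<close> scaled
  numbers; \<open>N\<close> bounds the passes of every loop.\<close>

locale psc_input =
  fixes I :: "nat psc" and es :: "nat set list" and inp :: "nat \<Rightarrow> nat" and n m N X Y :: nat
  assumes wf: "psc_wf I" and forest: "inforest (ground I) (arcs I)"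
    and ground: "ground I = {..<n}"
    and es: "distinct es" "set es = hyperedges I" "length es = m"
    and sizes: "inp 0 = n" "inp 1 = m" "n \<le> N" "m \<le> N" "N \<le> X" "2 \<le> X" "N * Y \<le> X" "0 < Y"
    and cost_cells: "\<And>v. v < n \<Longrightarrow> of_nat (inp (2 + 2 * v)) = elem_cost I v * of_nat (inp (2 + 2 * v + 1))"
      "\<And>v. v < n \<Longrightarrow> 0 < inp (2 + 2 * v + 1)"
    and arc_cells: "\<And>u v. u < n \<Longrightarrow> v < n \<Longrightarrow> (inp (2 + 2 * n + (n * u + v)) \<noteq> 0) = ((u, v) \<in> arcs I)"
    and weight_cells: "\<And>j. j < m \<Longrightarrow> of_nat (inp (2 + 2 * n + n * n + (n + 2) * j)) =
        weight I (es ! j) * of_nat (inp (2 + 2 * n + n * n + (n + 2) * j + 1))"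
      "\<And>j. j < m \<Longrightarrow> 0 < inp (2 + 2 * n + n * n + (n + 2) * j + 1)"
    and incidence_cells: "\<And>j v. j < m \<Longrightarrow> v < n \<Longrightarrow>
        (inp (2 + 2 * n + n * n + (n + 2) * j + (2 + v)) \<noteq> 0) = (v \<in> es ! j)"
    and prod_le: "\<And>U. finite U \<Longrightarrow> (\<Prod>u\<in>U. inp u) \<le> Y"
begin

lemma bounds: "n \<le> X" "m \<le> X" "n * Y \<le> X" "m * Y \<le> X"
  using sizes mult_le_mono1[of n N Y] mult_le_mono1[of m N Y] by linarith+

definition scaled_cost :: "nat \<Rightarrow> nat" where
  "scaled_cost v = inp (2 + 2 * v) * (\<Prod>u\<in>{..<n} - {v}. inp (2 + 2 * u + 1))"

definition scaled_weight :: "nat \<Rightarrow> nat" where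
  "scaled_weight j = inp (2 + 2 * n + n * n + (n + 2) * j) *
     (\<Prod>i\<in>{..<m} - {j}. inp (2 + 2 * n + n * n + (n + 2) * i + 1))"

definition scaled_total :: "nat set \<Rightarrow> nat" where
  "scaled_total T = (\<Sum>v\<in>T. scaled_cost v)"

definition scaled_coverage :: "nat set \<Rightarrow> nat" where
  "scaled_coverage T = (\<Sum>j | j < m \<and> es ! j \<inter> T \<noteq> {}. scaled_weight j)"

definition support :: "(nat \<Rightarrow> nat) \<Rightarrow> nat set" where
  "support f = {v. v < n \<and> f v \<noteq> 0}"

definition ready :: "state \<Rightarrow> bool" where
  "ready s \<longleftrightarrow> s 0 = inp \<and> s 2 0 = n \<and> s 3 0 = m \<and> (\<forall>v<n. s 4 v = scaled_cost v) \<and>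
     (\<forall>j<m. s 5 j = scaled_weight j) \<and> (\<forall>u<n. s 6 u = next_vertex I u)"

lemma ready_cong:
  "s' 0 = s 0 \<Longrightarrow> s' 2 = s 2 \<Longrightarrow> s' 3 = s 3 \<Longrightarrow> s' 4 = s 4 \<Longrightarrow> s' 5 = s 5 \<Longrightarrow> s' 6 = s 6 \<Longrightarrow>
   ready s' = ready s"
  by (simp add: ready_def)

text \<open>\<open>prod_le\<close> speaks of sets of cells, so every factor must come from a
  different cell: denominators are separated by the positive stride, and the numerator from them by
  the last assumption.\<close>

lemma scaled_prod_le:
  assumes "0 < D" "U \<subseteq> {..<H} - {v}" "\<And>u. B + D * v \<noteq> B + D * u + 1"
  shows "inp (B + D * v) * (\<Prod>u\<in>U. inp (B + D * u + 1)) \<le> Y"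
proof -
  have fin: "finite U" using assms by (auto intro: finite_subset)
  have inj: "inj_on (\<lambda>u. B + D * u + 1) U" using assms by (auto intro!: inj_onI)
  have "inp (B + D * v) * (\<Prod>u\<in>U. inp (B + D * u + 1)) =
    (\<Prod>i\<in>insert (B + D * v) ((\<lambda>u. B + D * u + 1) ` U). inp i)"
    using fin assms(3) prod.reindex[OF inj, of inp] by (subst prod.insert) (auto simp: o_def)
  also have "\<dots> \<le> Y" using fin by (intro prod_le) simp
  finally show ?thesis .
qed

lemma cost_cell_disjoint: "2 + 2 * v \<noteq> 2 + 2 * u + (1::nat)"
  by presburger

lemma weight_cell_disjoint: 
  assumes "2 \<le> (d::nat)" shows "B + d * v \<noteq> B + d * u + 1"
proof
  assume "B + d * v = B + d * u + 1"
  then have *: "d * v = d * u + 1" by simp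
  then have "d dvd d * u + 1" by (metis dvd_triv_left)
  then have "d dvd 1" using dvd_add_right_iff[of d "d * u" 1] by simp
  then show False using assms by simp
qed

lemma scaled_cost_le: "scaled_cost v \<le> Y"
  unfolding scaled_cost_def using scaled_prod_le[of 2 _ n v 2] cost_cell_disjoint by simp

lemma scaled_weight_le: "scaled_weight j \<le> Y"
  unfolding scaled_weight_def
  by (rule scaled_prod_le[of "n + 2" _ m j]) (simp, simp, rule weight_cell_disjoint, simp)

lemma scaled_total_le: "T \<subseteq> {..<n} \<Longrightarrow> scaled_total T \<le> X"
proof -
  assume T: "T \<subseteq> {..<n}"
  have "scaled_total T \<le> card T * Y"
    unfolding scaled_total_def using sum_bounded_above[of T scaled_cost Y] scaled_cost_le by simp
  also have "\<dots> \<le> n * Y" using card_mono[OF _ T] by (intro mult_le_mono1) simp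
  finally show ?thesis using bounds by simp
qed

lemma scaled_coverage_partial_le: "U \<subseteq> {..<m} \<Longrightarrow> (\<Sum>j\<in>U. scaled_weight j) \<le> X"
proof -
  assume T: "U \<subseteq> {..<m}"
  have "(\<Sum>j\<in>U. scaled_weight j) \<le> card U * Y"
    using sum_bounded_above[of U scaled_weight Y] scaled_weight_le by simp
  also have "\<dots> \<le> m * Y" using card_mono[OF _ T] by (intro mult_le_mono1) simp
  finally show ?thesis using bounds by simp
qed

lemma scaled_total_rat:
  "\<exists>D>0. \<forall>T\<subseteq>{..<n}. rat_of_nat (scaled_total T) = D * total_cost I T"
proof (intro exI conjI allI impI)
  let ?D = "\<Prod>u<n. rat_of_nat (inp (2 + 2 * u + 1))"
  show "0 < ?D" using cost_cells(2) by (intro prod_pos) simp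
  fix T assume T: "T \<subseteq> {..<n}"
  have "rat_of_nat (scaled_cost v) = ?D * elem_cost I v" if "v < n" for v
    using that cost_cells(1)[OF that] unfolding scaled_cost_def
    by (subst prod.remove[of _ v]) (auto simp: ac_simps)
  then show "rat_of_nat (scaled_total T) = ?D * total_cost I T"
    unfolding scaled_total_def total_cost_def using T
    by (auto simp: sum_distrib_left intro!: sum.cong)
qed

lemma scaled_coverage_rat:
  "\<exists>D>0. \<forall>T. rat_of_nat (scaled_coverage T) = D * coverage I T"
proof (intro exI conjI allI)
  let ?D = "\<Prod>i<m. rat_of_nat (inp (2 + 2 * n + n * n + (n + 2) * i + 1))"
  show "0 < ?D" using weight_cells(2) by (intro prod_pos) simp
  fix T
  have w: "rat_of_nat (scaled_weight j) = ?D * weight I (es ! j)" if "j < m" for j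
    using that weight_cells(1)[OF that] unfolding scaled_weight_def
    by (subst prod.remove[of _ j]) (auto simp: ac_simps)
  have "bij_betw ((!) es) {j. j < m \<and> es ! j \<inter> T \<noteq> {}} {e. e \<in> hyperedges I \<and> e \<inter> T \<noteq> {}}"
  proof (rule bij_betw_imageI)
    show "inj_on ((!) es) {j. j < m \<and> es ! j \<inter> T \<noteq> {}}"
      using es by (intro inj_on_nth) auto
    show "(!) es ` {j. j < m \<and> es ! j \<inter> T \<noteq> {}} = {e. e \<in> hyperedges I \<and> e \<inter> T \<noteq> {}}"
      unfolding es(2)[symmetric] es(3)[symmetric] by (auto simp: set_conv_nth)
  qed
  then have "coverage I T = (\<Sum>j | j < m \<and> es ! j \<inter> T \<noteq> {}. weight I (es ! j))"
    unfolding coverage_def by (rule sum.reindex_bij_betw[symmetric])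
  then show "rat_of_nat (scaled_coverage T) = ?D * coverage I T"
    unfolding scaled_coverage_def using w by (auto simp: sum_distrib_left intro!: sum.cong)
qed

lemma scaled_total_mono: "S \<subseteq> T \<Longrightarrow> T \<subseteq> {..<n} \<Longrightarrow> scaled_total S \<le> scaled_total T"
  unfolding scaled_total_def by (rule sum_mono2) (auto intro: finite_subset)

lemma scaled_coverage_mono: "S \<subseteq> T \<Longrightarrow> scaled_coverage S \<le> scaled_coverage T"
  unfolding scaled_coverage_def by (rule sum_mono2) auto

text \<open>Scaling changes neither side of the cross-multiplied comparison of densities.\<close>

lemma greedy_step_scaled:
  assumes S: "S \<subseteq> {..<n}" and u: "u < n"
    and best: "\<And>v k. available I S v \<Longrightarrow> 0 < k \<Longrightarrow> k \<le> n \<Longrightarrow>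
      (scaled_coverage (S \<union> walk I v k) - scaled_coverage S) *
        (scaled_total (S \<union> walk I u l) - scaled_total S)
      \<le> (scaled_coverage (S \<union> walk I u l) - scaled_coverage S) *
        (scaled_total (S \<union> walk I v k) - scaled_total S)"
  shows "greedy_step I S (S \<union> walk I u l)"
proof -
  obtain C where C: "0 < C" "\<And>T. T \<subseteq> {..<n} \<Longrightarrow> rat_of_nat (scaled_total T) = C * total_cost I T"
    using scaled_total_rat by auto
  obtain D where D: "0 < D" "\<And>T. rat_of_nat (scaled_coverage T) = D * coverage I T"
    using scaled_coverage_rat by auto
  have ground_walk: "S \<union> walk I v k \<subseteq> {..<n}" if "v < n" for v k
    using S walk_ground[OF wf forest, of v k] ground that by auto
  have cov: "rat_of_nat (scaled_coverage (S \<union> walk I v k) - scaled_coverage S) =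
    D * (coverage I (S \<union> walk I v k) - coverage I S)" for v k
    using D scaled_coverage_mono[of S "S \<union> walk I v k"] by (simp add: of_nat_diff right_diff_distrib)
  have tot: "rat_of_nat (scaled_total (S \<union> walk I v k) - scaled_total S) =
    C * total_cost I (walk I v k - S)" if "v < n" for v k
  proof -
    have fin: "finite (S \<union> walk I v k)" using ground_walk[OF that, of k] by (auto intro: finite_subset)
    have "total_cost I (S \<union> walk I v k) = total_cost I S + total_cost I (walk I v k - S)"
      unfolding total_cost_def using fin
      by (subst Un_Diff_cancel[symmetric], subst sum.union_disjoint) (auto intro: finite_subset)
    then show ?thesis
      using C S ground_walk[OF that, of k] scaled_total_mono[of S "S \<union> walk I v k"]
      by (simp add: of_nat_diff right_diff_distrib ring_distribs)
  qed
  show ?thesis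
  proof (rule greedy_step_walk[OF wf forest])
    fix v k assume v: "available I S v" and k: "0 < k" "k \<le> card (ground I)"
    then have vn: "v < n" "k \<le> n" by (auto simp: available_def ground)
    have "rat_of_nat ((scaled_coverage (S \<union> walk I v k) - scaled_coverage S) *
        (scaled_total (S \<union> walk I u l) - scaled_total S))
      \<le> rat_of_nat ((scaled_coverage (S \<union> walk I u l) - scaled_coverage S) *
        (scaled_total (S \<union> walk I v k) - scaled_total S))"
      using best[OF v k(1) vn(2)] by (simp only: of_nat_le_iff)
    then have "(C * D) * ((coverage I (S \<union> walk I v k) - coverage I S) * total_cost I (walk I u l - S))
      \<le> (C * D) * ((coverage I (S \<union> walk I u l) - coverage I S) * total_cost I (walk I v k - S))"
      unfolding of_nat_mult cov tot[OF vn(1)] tot[OF u] by (simp only: ac_simps)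
    then show "(coverage I (S \<union> walk I v k) - coverage I S) * total_cost I (walk I u l - S)
      \<le> (coverage I (S \<union> walk I u l) - coverage I S) * total_cost I (walk I v k - S)"
      using C D by (simp only: mult_le_cancel_left_pos mult_pos_pos)
  qed (use S u in \<open>auto simp: ground\<close>)
qed

section \<open>Correctness of the program\<close>

lemmas X2 = sizes(6)
lemmas nX = sizes(3) bounds(1)
lemmas mX = sizes(4) bounds(2)

lemma arc_cell_eval:
  assumes "s 0 = inp" "s 2 0 = n" "eval_exp u s < n" "eval_exp v s < n"
  shows "eval_exp (arc_cell u v) s \<noteq> 0 \<longleftrightarrow> (eval_exp u s, eval_exp v s) \<in> arcs I"
  using arc_cells[OF assms(3,4)] assms by (simp add: arc_cell_def)

lemma incidence_cell_eval:
  assumes "s 0 = inp" "s 2 0 = n" "eval_exp j s < m" "eval_exp v s < n"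
  shows "eval_exp (incidence_cell j v) s \<noteq> 0 \<longleftrightarrow> eval_exp v s \<in> es ! eval_exp j s"
  using incidence_cells[OF assms(3,4)] assms
  by (simp add: incidence_cell_def edge_base_def edge_stride_def)

lemma arcs_less: "(u, v) \<in> arcs I \<Longrightarrow> u < n \<and> v < n"
  using arcs_ground[OF wf, of u v] by (simp add: ground)

lemma wp_next_com:
  assumes s: "s 0 = inp" "s 2 0 = n"
  shows "wp N X next_com (\<lambda>s'. \<forall>u<n. s' 6 u = next_vertex I u) s"
  unfolding next_com_def
proof (rule wp_For[OF X2 nX, where J = "\<lambda>i s'. \<forall>u<i. s' 6 u = next_vertex I u"], goal_cases)
  case (4 i s')
  show ?case
  proof (intro wp_Seq wp_Write[OF X2], goal_cases)
    case 2
    show ?case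
    proof (rule wp_For[OF X2 nX, where J = "\<lambda>j s''. (\<forall>u<i. s'' 6 u = next_vertex I u) \<and>
        s'' 6 i = (if \<exists>v<j. (i, v) \<in> arcs I then next_vertex I i else i)"], goal_cases)
      case (4 j s'')
      then have st: "s'' 0 = inp" "s'' 2 0 = n" "s'' 9 0 = i" "s'' 10 0 = j"
        using s \<open>s' 9 0 = i\<close> \<open>\<forall>a. a \<notin> insert 9 _ \<longrightarrow> s' a = s a\<close> by simp_all
      have arc: "eval_exp (arc_cell (Scalar 9) (Scalar 10)) s'' \<noteq> 0 \<longleftrightarrow> (i, j) \<in> arcs I"
        using arc_cell_eval[of s'' "Scalar 9" "Scalar 10"] st \<open>i < n\<close> \<open>j < n\<close> by simp
      show ?case
      proof (intro wp_Cond[OF X2] wp_Write[OF X2] wp_Skip, goal_cases)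
        case 1
        then show ?case using st \<open>j < n\<close> nX by simp
      next
        case 2
        then have "next_vertex I i = j" using arc next_vertex_arc[OF wf forest] by simp
        then show ?case using 2 4 st arc by (auto simp: less_Suc_eq)
      next
        case 3
        then show ?case using 4 arc by (auto simp: less_Suc_eq)
      qed
    next
      case (5 s'')
      have "(\<exists>v<n. (i, v) \<in> arcs I) = (\<exists>v. (i, v) \<in> arcs I)" using arcs_less by auto
      then show ?case using 5 next_vertex_outside[of i I] by (auto simp: less_Suc_eq)
    qed (use 4 s in auto)
  qed (use 4 nX in auto)
qed (use s in auto)

lemma wp_copy_com:
  assumes s: "s 2 0 = n"
  shows "wp N X copy_com (\<lambda>s'. \<forall>v<n. s' 7 v = s 1 v) s"
  unfolding copy_com_def
proof (rule wp_For[OF X2 nX, where J = "\<lambda>i s'. \<forall>v<i. s' 7 v = s 1 v"], goal_cases)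
  case (4 i s')
  then have "s' 1 = s 1" "s' 11 0 = i" by simp_all
  moreover from this have "s 1 i \<le> X" using \<open>cells_le X s'\<close> by (metis cells_le_def)
  ultimately show ?case
    using 4 by (intro wp_Write[OF X2]) (auto simp: less_Suc_eq)
qed (use s in auto)

lemma wp_eval_com:
  assumes s: "ready s"
  shows "wp N X eval_com (\<lambda>s'. s' 14 0 = scaled_coverage (support (s 7)) \<and>
    s' 15 0 = scaled_total (support (s 7))) s"
  unfolding eval_com_def
proof (intro wp_Seq wp_Write[OF X2], goal_cases)
  case 3
  let ?s = "s(14 := (s 14)(eval_exp (Const 0) s := eval_exp (Const 0) s))"
  let ?s' = "?s(15 := (?s 15)(eval_exp (Const 0) ?s := eval_exp (Const 0) ?s))"
  have sub: "support (s 7) \<inter> {..<i} \<subseteq> {..<n}" for i by (auto simp: support_def)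
  have cov_le: "(\<Sum>j | j < i \<and> es ! j \<inter> support (s 7) \<noteq> {}. scaled_weight j) \<le> X" if "i \<le> m" for i
    using that by (intro scaled_coverage_partial_le) auto
  show ?case
  proof (rule wp_For[OF X2 nX, where J = "\<lambda>i s'. s' 14 0 = 0 \<and>
      s' 15 0 = scaled_total (support (s 7) \<inter> {..<i})"], goal_cases)
    case 1 show ?case by (simp add: scaled_total_def)
  next
    case 2 then show ?case using s by (simp add: ready_def)
  next
    case (4 i s')
    have step: "support (s 7) \<inter> {..<Suc i} =
      (if s 7 i = 0 then support (s 7) \<inter> {..<i} else insert i (support (s 7) \<inter> {..<i}))"
      using 4 by (auto simp: support_def less_Suc_eq)
    have add: "scaled_total (insert i (support (s 7) \<inter> {..<i})) =
      scaled_total (support (s 7) \<inter> {..<i}) + scaled_cost i"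
      by (simp add: scaled_total_def)
    have cell: "s' 4 i = scaled_cost i" "s' 7 = s 7" using 4 s by (simp_all add: ready_def)
    show ?case
    proof (intro wp_Cond[OF X2] wp_Write[OF X2] wp_Skip, goal_cases)
      case 1
      then show ?case using 4 cell add step scaled_total_le[OF sub[of "Suc i"]] by simp
    qed (use 4 cell add step in auto)
  next
    case (5 s')
    then have fr: "s' 0 = inp" "s' 2 0 = n" "s' 3 0 = m" "s' 7 = s 7" "\<And>j. j < m \<Longrightarrow> s' 5 j = scaled_weight j"
      using s by (simp_all add: ready_def)
    have "support (s 7) \<inter> {..<n} = support (s 7)" by (auto simp: support_def)
    then have tot: "s' 15 0 = scaled_total (support (s 7))" using 5 by simp
    show ?case
    proof (rule wp_For[OF X2 mX, where J = "\<lambda>j s''.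
        s'' 14 0 = (\<Sum>j' | j' < j \<and> es ! j' \<inter> support (s 7) \<noteq> {}. scaled_weight j')"], goal_cases)
      case 1 show ?case using 5 by simp
    next
      case 2 then show ?case using fr by simp
    next
      case (4 j s'')
      then have fr': "s'' 0 = inp" "s'' 2 0 = n" "s'' 7 = s 7" "\<And>j. j < m \<Longrightarrow> s'' 5 j = scaled_weight j"
        "s'' 12 0 = j"
        using fr by simp_all
      show ?case
      proof (intro wp_Seq wp_Write[OF X2], goal_cases)
        case 2
        show ?case
        proof (rule wp_For[OF X2 nX, where J = "\<lambda>v t. t 14 0 = s'' 14 0 \<and>
            t 13 0 = of_bool (\<exists>w<v. w \<in> es ! j \<and> s 7 w \<noteq> 0)"], goal_cases)
          case 2 then show ?case using fr' by simp
        next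
          case (4 v t)
          then have t: "t 0 = inp" "t 2 0 = n" "t 7 = s 7" "t 12 0 = j" "t 11 0 = v"
            using fr' by simp_all
          have inc: "eval_exp (incidence_cell (Scalar 12) (Scalar 11)) t \<noteq> 0 \<longleftrightarrow> v \<in> es ! j"
            using incidence_cell_eval[of t "Scalar 12" "Scalar 11"] t \<open>j < m\<close> \<open>v < n\<close> by simp
          show ?case
          proof (intro wp_Cond[OF X2] wp_Write[OF X2] wp_Skip, goal_cases)
            case 2
            then have "v \<in> es ! j \<and> s 7 v \<noteq> 0" using inc t by simp
            then show ?case using 4 by (auto simp: less_Suc_eq)
          next
            case 3
            then have "\<not> (v \<in> es ! j \<and> s 7 v \<noteq> 0)" using inc t by auto
            then have "(\<exists>w<Suc v. w \<in> es ! j \<and> s 7 w \<noteq> 0) = (\<exists>w<v. w \<in> es ! j \<and> s 7 w \<noteq> 0)"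
              by (auto simp: less_Suc_eq)
            then show ?case using 4 by simp
          qed (use X2 in auto)
        next
          case (5 t)
          then have t: "t 12 0 = j" "t 5 j = scaled_weight j" "t 14 0 = s'' 14 0"
            using fr' \<open>j < m\<close> by simp_all
          let ?U = "\<lambda>j. {j'. j' < j \<and> es ! j' \<inter> support (s 7) \<noteq> {}}"
          have "es ! j \<subseteq> {..<n}"
            using es \<open>j < m\<close> hyperedge_ground[OF wf, of "es ! j"] nth_mem[of j es] by (simp add: ground)
          then have "(\<exists>w<n. w \<in> es ! j \<and> s 7 w \<noteq> 0) \<longleftrightarrow> es ! j \<inter> support (s 7) \<noteq> {}"
            by (auto simp: support_def)
          then have h: "t 13 0 = of_bool (es ! j \<inter> support (s 7) \<noteq> {})" using 5 by simp
          have "?U (Suc j) = (if es ! j \<inter> support (s 7) \<noteq> {} then insert j (?U j) else ?U j)"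
            by (auto simp: less_Suc_eq)
          then have sum: "(\<Sum>j'\<in>?U (Suc j). scaled_weight j') =
            (\<Sum>j'\<in>?U j. scaled_weight j') + t 13 0 * scaled_weight j"
            using h by (simp add: add.commute)
          have J: "s'' 14 0 = (\<Sum>j'\<in>?U j. scaled_weight j')" using 4 by simp
          show ?case
          proof (intro wp_Write[OF X2], goal_cases)
            case 1
            then show ?case using t sum J cov_le[of "Suc j"] \<open>j < m\<close> by simp
          next
            case 2
            then show ?case using t sum J by simp
          qed
        qed auto
      qed simp
    next
      case (5 s'')
      then show ?case using tot by (simp add: scaled_coverage_def)
    qed simp
  qed simp
qed auto

lemma wp_avail_com:
  assumes s: "s 0 = inp" "s 2 0 = n" "s 9 0 = u" "u < n"
  shows "wp N X avail_com (\<lambda>s'. eval_exp avail_exp s' \<noteq> 0 \<longleftrightarrow> available I (support (s 1)) u) s"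
  unfolding avail_com_def
proof (intro wp_Seq wp_Write[OF X2], goal_cases)
  case 3
  show ?case
  proof (rule wp_For[OF X2 nX, where J = "\<lambda>i s'. (s' 23 0 \<noteq> 0 \<longleftrightarrow> (\<exists>w<i. (w, u) \<in> arcs I)) \<and>
      (s' 24 0 \<noteq> 0 \<longleftrightarrow> (\<exists>w<i. (w, u) \<in> arcs I \<and> s 1 w \<noteq> 0))"], goal_cases)
    case (4 i s')
    then have st: "s' 0 = inp" "s' 2 0 = n" "s' 9 0 = u" "s' 11 0 = i" "s' 1 = s 1"
      using s by simp_all
    have arc: "eval_exp (arc_cell (Scalar 11) (Scalar 9)) s' \<noteq> 0 \<longleftrightarrow> (i, u) \<in> arcs I"
      using arc_cell_eval[of s' "Scalar 11" "Scalar 9"] st \<open>u < n\<close> \<open>i < n\<close> by simp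
    have ex: "(\<exists>w<Suc i. P w) \<longleftrightarrow> P i \<or> (\<exists>w<i. P w)" for P
      by (auto simp: less_Suc_eq)
    show ?case
    proof (intro wp_Cond[OF X2] wp_Seq wp_Write[OF X2] wp_Skip, goal_cases)
      case 5
      then show ?case using 4 st arc unfolding ex by simp
    qed (use 4 st arc X2 in \<open>simp_all add: ex\<close>)
  next
    case (5 s')
    then have st: "s' 9 0 = u" "s' 1 = s 1" using s by simp_all
    have "eval_exp avail_exp s' \<noteq> 0 \<longleftrightarrow> s 1 u = 0 \<and> (s' 23 0 = 0 \<or> s' 24 0 \<noteq> 0)"
      using st by (auto simp: avail_exp_def)
    also have "\<dots> \<longleftrightarrow> available I (support (s 1)) u"
      using 5 arcs_less \<open>u < n\<close> by (auto simp: available_def support_def ground) 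
    finally show ?case .
  qed (use s in auto)
qed auto

text \<open>\<open>P\<close> collects the pairs of start and length tried so far. The first
  alternative requires \<open>P\<close> to be empty, so after any attempt a walk is known to be
  recorded.\<close>

definition best_of :: "nat set \<Rightarrow> (nat \<times> nat) set \<Rightarrow> state \<Rightarrow> bool" where
  "best_of S P s \<longleftrightarrow> (s 18 0 = 0 \<and> P = {}) \<or>
     (0 < s 18 0 \<and> s 18 0 \<le> n \<and> available I S (s 19 0) \<and>
      s 20 0 = scaled_coverage (S \<union> walk I (s 19 0) (s 18 0)) \<and>
      s 21 0 = scaled_total (S \<union> walk I (s 19 0) (s 18 0)) \<and>
      (\<forall>(v, k)\<in>P.
        (scaled_coverage (S \<union> walk I v k) - scaled_coverage S) * (s 21 0 - scaled_total S)
        \<le> (s 20 0 - scaled_coverage S) * (scaled_total (S \<union> walk I v k) - scaled_total S)))"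

lemma best_of_cong:
  "s' 18 = s 18 \<Longrightarrow> s' 19 = s 19 \<Longrightarrow> s' 20 = s 20 \<Longrightarrow> s' 21 = s 21 \<Longrightarrow> best_of S P s' = best_of S P s"
  by (simp add: best_of_def)

lemma wp_best_of_insert:
  assumes best: "best_of S P s" and u: "available I S (s 9 0)" and l: "s 10 0 < n"
    and s: "s 14 0 = scaled_coverage (S \<union> walk I (s 9 0) (Suc (s 10 0)))"
      "s 15 0 = scaled_total (S \<union> walk I (s 9 0) (Suc (s 10 0)))"
      "s 16 0 = scaled_coverage S" "s 17 0 = scaled_total S"
  shows "wp N X (Cond better_exp update_com Skip) (best_of S (insert (s 9 0, Suc (s 10 0)) P)) s"
proof (rule wp_cells_le)
  assume le: "cells_le X s"
  show ?thesis
    unfolding update_com_def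
  proof (intro wp_Cond[OF X2] wp_Seq wp_Write[OF X2] wp_Skip, goal_cases)
    case 1
    then show ?case using l nX by simp
  next
    case 5
    have "(scaled_coverage (S \<union> walk I v k) - scaled_coverage S) * (s 15 0 - scaled_total S)
        \<le> (s 14 0 - scaled_coverage S) * (scaled_total (S \<union> walk I v k) - scaled_total S)"
      if "(v, k) \<in> P" for v k
    proof (rule cross_mult_trans)
      from best that have P: "s 18 0 \<noteq> 0"
        "(scaled_coverage (S \<union> walk I v k) - scaled_coverage S) * (s 21 0 - scaled_total S)
        \<le> (s 20 0 - scaled_coverage S) * (scaled_total (S \<union> walk I v k) - scaled_total S)"
        by (auto simp: best_of_def)
      then show "(scaled_coverage (S \<union> walk I v k) - scaled_coverage S) * (s 21 0 - scaled_total S)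
        \<le> (s 20 0 - scaled_coverage S) * (scaled_total (S \<union> walk I v k) - scaled_total S)" by simp
      show "(s 20 0 - scaled_coverage S) * (s 15 0 - scaled_total S) <
         (s 14 0 - scaled_coverage S) * (s 21 0 - scaled_total S)"
        using 5 P(1) s by (simp add: better_exp_def)
    qed
    then show ?case using u l s by (auto simp: best_of_def)
  next
    case 6
    then show ?case
      using best s by (auto simp: better_exp_def best_of_def)
  qed (use le in \<open>auto simp: cells_le_def\<close>)
qed

lemma walk_Suc: "walk I u (Suc l) = insert ((next_vertex I ^^ l) u) (walk I u l)"
  by (simp add: walk_def lessThan_Suc)

lemma next_vertex_iterate_less: "u < n \<Longrightarrow> (next_vertex I ^^ l) u < n"
  by (induction l) (use next_vertex_ground[OF wf forest] in \<open>auto simp: ground\<close>)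

lemma support_less: "support f \<subseteq> {..<n}"
  by (auto simp: support_def)

definition round_state :: "(nat \<Rightarrow> nat) \<Rightarrow> state \<Rightarrow> bool" where
  "round_state \<pi> s \<longleftrightarrow> ready s \<and> s 1 = \<pi> \<and> s 16 0 = scaled_coverage (support \<pi>) \<and>
     s 17 0 = scaled_total (support \<pi>)"

lemma round_state_cong:
  "s' 0 = s 0 \<Longrightarrow> s' 1 = s 1 \<Longrightarrow> s' 2 = s 2 \<Longrightarrow> s' 3 = s 3 \<Longrightarrow> s' 4 = s 4 \<Longrightarrow> s' 5 = s 5 \<Longrightarrow> s' 6 = s 6 \<Longrightarrow>
   s' 16 = s 16 \<Longrightarrow> s' 17 = s 17 \<Longrightarrow> round_state \<pi> s' = round_state \<pi> s"
  using ready_cong[of s' s] by (simp add: round_state_def)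

text \<open>Array 7 starts as a copy of the positions and so represents the placed set. Marking the
  current vertex in each pass makes it represent the union with a walk one step longer, so all
  lengths from one start are evaluated along a single traversal.\<close>

lemma wp_walk_com:
  assumes s: "round_state \<pi> s" "s 9 0 = u" and u: "u < n" "available I (support \<pi>) u"
    and best: "best_of (support \<pi>) P s"
  shows "wp N X walk_com (best_of (support \<pi>) (P \<union> {u} \<times> {0<..n})) s"
proof -
  let ?S = "support \<pi>"
  have n: "s 2 0 = n" using s by (simp add: round_state_def ready_def)
  show ?thesis
    unfolding walk_com_def
  proof (rule wp_Seq[OF wp_mono[OF wp_frame[OF wp_copy_com[of s, OF n]]]],
      intro wp_Seq wp_Write[OF X2], goal_cases)
    case (1 s')
    then show ?case using s u nX by simp
  next
    case (2 s')
    then have fr: "\<And>a. a \<notin> {7, 11} \<Longrightarrow> s' a = s a" by auto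
    have s': "round_state \<pi> s'" "s' 9 0 = u" "best_of ?S P s'"
      using s best round_state_cong[of s' s \<pi>] best_of_cong[of s' s ?S P] fr by simp_all
    have "s 1 = \<pi>" using s by (simp add: round_state_def)
    then have T: "support (s' 7) = ?S" using 2 by (simp add: support_def conj_commute cong: conj_cong)
    show ?case
    proof (rule wp_For[OF X2 nX, where J = "\<lambda>l t. t 22 0 = (next_vertex I ^^ l) u \<and>
        support (t 7) = ?S \<union> walk I u l \<and> best_of ?S (P \<union> {u} \<times> {0<..l}) t"], goal_cases)
      case 1
      have "best_of ?S P (set_cell 10 0 0 (s'(22 := (s' 22)(0 := u)))) = best_of ?S P s'"
        by (rule best_of_cong) simp_all
      then show ?case using s' T by (simp add: walk_def)
    next
      case 2
      then show ?case using s' by (simp add: round_state_def ready_def)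
    next
      case (4 l t)
      have t: "round_state \<pi> t" "t 9 0 = u" "t 10 0 = l" "t 22 0 = (next_vertex I ^^ l) u"
        "support (t 7) = ?S \<union> walk I u l" "best_of ?S (P \<union> {u} \<times> {0<..l}) t"
        using 4 s' round_state_cong[of t s' \<pi>] by simp_all
      show ?case
      proof (intro wp_Seq wp_Write[OF X2], goal_cases)
        case 1
        show ?case using X2 by simp
      next
        case 2
        let ?t = "t(7 := (t 7)(eval_exp (Scalar 22) t := eval_exp (Const 1) t))"
        have t': "round_state \<pi> ?t" using t(1) round_state_cong[of ?t t \<pi>] by simp
        have best': "best_of ?S (P \<union> {u} \<times> {0<..l}) ?t" using t(6) best_of_cong[of ?t t] by simp
        have T': "support (?t 7) = ?S \<union> walk I u (Suc l)"
          using t(4,5) next_vertex_iterate_less[OF u(1), of l]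
          unfolding walk_Suc support_def by auto
        have rd: "ready ?t" using t' by (simp add: round_state_def)
        show ?case
        proof (rule wp_mono[OF wp_frame[OF wp_eval_com[of ?t, OF rd]]], goal_cases)
          case (1 t2)
          then have fr: "\<And>a. a \<notin> {11, 12, 13, 14, 15} \<Longrightarrow> t2 a = ?t a" by auto
          have t2: "round_state \<pi> t2" "t2 9 0 = u" "t2 10 0 = l" "t2 22 0 = (next_vertex I ^^ l) u"
            "support (t2 7) = ?S \<union> walk I u (Suc l)" "best_of ?S (P \<union> {u} \<times> {0<..l}) t2"
            "t2 14 0 = scaled_coverage (?S \<union> walk I u (Suc l))"
            "t2 15 0 = scaled_total (?S \<union> walk I u (Suc l))"
            using 1 t' t T' best' round_state_cong[of t2 ?t \<pi>] best_of_cong[of t2 ?t] fr by simp_all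
          have upd: "insert (u, Suc l) (P \<union> {u} \<times> {0<..l}) = P \<union> {u} \<times> {0<..Suc l}"
            by auto
          have "wp N X (Cond better_exp update_com Skip) (best_of ?S (P \<union> {u} \<times> {0<..Suc l})) t2"
            using wp_best_of_insert[OF t2(6)] t2 u(2) \<open>l < n\<close> upd by (simp add: round_state_def)
          from wp_frame[OF this] show ?case
          proof (rule wp_Seq[OF wp_mono], intro wp_Write[OF X2], goal_cases)
            case (1 t3)
            then show ?case by (intro eval_Read_le)
          next
            case (2 t3)
            then have fr: "\<And>a. a \<notin> {18, 19, 20, 21} \<Longrightarrow> t3 a = t2 a" by auto
            have "t2 6 (t2 22 0) = next_vertex I ((next_vertex I ^^ l) u)"
              using t2(1,4) next_vertex_iterate_less[OF u(1), of l]
              by (simp add: round_state_def ready_def)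
            then show ?case
              using 2 t2 fr best_of_cong[of "set_cell 10 0 (Suc l)
                (t3(22 := (t3 22)(0 := next_vertex I ((next_vertex I ^^ l) u))))" t3]
              by simp
          qed
        qed
      qed
    qed simp_all
  qed
qed

text \<open>A walk may run through vertices that are already placed; these are skipped and keep
  their positions. The first vertex is available, and each later one has the preceding vertex of the
  walk as a placed predecessor.\<close>

lemma wp_append_com:
  assumes s: "ready s" "s 18 0 = l" "s 19 0 = u" "s 8 0 = card S"
    and l: "l \<le> n" and u: "available I S u"
    and S: "support (s 1) = S" "partial_ordering I S (s 1)"
  shows "wp N X append_com (\<lambda>t. support (t 1) = S \<union> walk I u l \<and>
    partial_ordering I (S \<union> walk I u l) (t 1) \<and> t 8 0 = card (S \<union> walk I u l) \<and>
    (\<forall>v\<in>S. t 1 v = s 1 v)) s"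
  unfolding append_com_def
proof (intro wp_Seq wp_Write[OF X2], goal_cases)
  case 1
  then show ?case by (intro eval_Read_le)
next
  case 2
  have un: "u < n" using u by (simp add: available_def ground)
  have lX: "l \<le> N" "l \<le> X" using l nX by simp_all
  show ?case
  proof (rule wp_For[OF X2 lX, where J = "\<lambda>i t. t 22 0 = (next_vertex I ^^ i) u \<and>
      support (t 1) = S \<union> walk I u i \<and> partial_ordering I (S \<union> walk I u i) (t 1) \<and>
      t 8 0 = card (S \<union> walk I u i) \<and> (\<forall>v\<in>S. t 1 v = s 1 v)"], goal_cases)
    case 1
    then show ?case using s S by (simp add: walk_def)
  next
    case 2
    then show ?case using s by simp
  next
    case (4 i t)
    let ?A = "S \<union> walk I u i"
    define x where "x = (next_vertex I ^^ i) u"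
    have x: "x < n" unfolding x_def by (rule next_vertex_iterate_less[OF un])
    have t: "t 22 0 = x" "support (t 1) = ?A" "partial_ordering I ?A (t 1)" "t 8 0 = card ?A"
      "\<And>v. v \<in> S \<Longrightarrow> t 1 v = s 1 v" "t 6 = s 6"
      using 4 by (simp_all add: x_def)
    have next_x: "t 6 x = next_vertex I x" using t s x by (simp add: ready_def)
    have walk: "S \<union> walk I u (Suc i) = insert x ?A" by (simp add: walk_Suc x_def)
    have mem: "x \<in> ?A \<longleftrightarrow> t 1 x \<noteq> 0" using t(2) x by (auto simp: support_def)
    have fin: "finite ?A" unfolding t(2)[symmetric] using support_less finite_subset by blast
    have snoc: "partial_ordering I (insert x ?A) ((t 1)(x := Suc (card ?A)))" if nx: "x \<notin> ?A"
    proof (rule partial_ordering_snoc[OF t(3) fin _ nx])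
      show "x \<in> ground I" using x by (simp add: ground)
      assume preds: "{w. (w, x) \<in> arcs I} \<noteq> {}"
      show "\<exists>w\<in>?A. (w, x) \<in> arcs I"
      proof (cases i)
        case 0
        then show ?thesis using preds u by (auto simp: available_def x_def)
      next
        case (Suc j)
        define y where "y = (next_vertex I ^^ j) u"
        have y: "y \<in> ?A" "x = next_vertex I y" using Suc by (auto simp: y_def x_def walk_Suc)
        \<comment> \<open>If \<open>y\<close> were a sink, \<open>next_vertex\<close> would repeat
          it and \<open>x = y\<close> would already be placed; so the step from \<open>y\<close> to
          \<open>x\<close> follows an actual arc.\<close>
        then obtain z where "(y, z) \<in> arcs I" using nx next_vertex_outside[of y I] by metis
        then show ?thesis using y next_vertex_arc[OF wf forest] by metis
      qed
    qed
    have "insert x ?A \<subseteq> {..<n}" using support_less[of "t 1"] x t(2) by auto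
    then have card: "card (insert x ?A) \<le> X" using card_mono[of "{..<n}" "insert x ?A"] nX by simp
    show ?case
    proof (intro wp_Seq wp_Cond[OF X2] wp_Write[OF X2] wp_Skip, goal_cases)
      case 1
      then have "x \<notin> ?A" using mem t by simp
      then show ?case using t card fin by simp
    next
      case 2
      then have "x \<notin> ?A" using mem t by simp
      then show ?case using t card fin by simp
    next
      case 3
      then show ?case by (intro eval_Read_le)
    next
      case 4
      then have nx: "x \<notin> ?A" using mem t by simp
      have "support ((t 1)(x := Suc (card ?A))) = insert x ?A"
        using t(2) x by (auto simp: support_def)
      then show ?case
        unfolding walk using t snoc[OF nx] nx fin next_x by (auto simp: x_def[symmetric])
    next
      case 5
      then show ?case by (intro eval_Read_le)
    next
      case 6
      then have "x \<in> ?A" using mem t by simp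
      then have "insert x ?A = ?A" by auto
      then show ?case unfolding walk using t next_x by (simp add: x_def[symmetric])
    qed
  qed auto
qed

text \<open>As long as vertices are missing, an available one exists, so the search ends with a
  recorded walk. Its start is unplaced, so the count of placed vertices grows strictly, whatever the
  gain; this is the variant of the main loop.\<close>

lemma wp_round_com:
  assumes s: "ready s" "s 8 0 = card (support (s 1))" "s 8 0 < n"
    and order: "greedy_ordering I (support (s 1)) (s 1)"
  shows "wp N X round_com (\<lambda>t. ready t \<and> t 8 0 = card (support (t 1)) \<and>
    greedy_ordering I (support (t 1)) (t 1) \<and> s 8 0 < t 8 0) s"
proof -
  let ?S = "support (s 1)"
  let ?Q = "\<lambda>t. ready t \<and> t 8 0 = card (support (t 1)) \<and>
    greedy_ordering I (support (t 1)) (t 1) \<and> s 8 0 < t 8 0"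
  let ?P = "\<lambda>i. {(v, k). v < i \<and> available I ?S v \<and> 0 < k \<and> k \<le> n}"
  have n: "s 2 0 = n" using s by (simp add: ready_def)
  show ?thesis
    unfolding round_com_def
  proof (rule wp_Seq[OF wp_mono[OF wp_frame[OF wp_copy_com[of s, OF n]]]], goal_cases)
    case (1 s1)
    then have fr1: "\<And>a. a \<notin> {7, 11} \<Longrightarrow> s1 a = s a" by auto
    have rd1: "ready s1" using s(1) ready_cong[of s1 s] fr1 by simp
    have T1: "support (s1 7) = ?S" using 1 by (simp add: support_def conj_commute cong: conj_cong)
    show ?case
    proof (rule wp_Seq[OF wp_mono[OF wp_frame[OF wp_eval_com[of s1, OF rd1]]]], goal_cases)
      case (1 s2)
      then have fr2: "\<And>a. a \<notin> {7, 11, 12, 13, 14, 15} \<Longrightarrow> s2 a = s a" using fr1 by auto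
      have rd2: "ready s2" using s(1) ready_cong[of s2 s] fr2 by simp
      have ev: "s2 14 0 = scaled_coverage ?S" "s2 15 0 = scaled_total ?S" using 1 T1 by simp_all
      show ?case
      proof (intro wp_Seq wp_Write[OF X2], goal_cases)
        case 4
        let ?s3 = "s2(16 := (s2 16)(0 := scaled_coverage ?S), 17 := (s2 17)(0 := scaled_total ?S),
          18 := (s2 18)(0 := 0))"
        have s3: "round_state (s 1) ?s3" "?s3 8 = s 8"
          using rd2 ready_cong[of ?s3 s2] fr2 by (simp_all add: round_state_def)
        have "wp N X (For 9 (Scalar 2) (Seq avail_com (Cond avail_exp walk_com Skip)))
          (wp N X append_com ?Q) ?s3"
        proof (rule wp_For[OF X2 nX, where J = "\<lambda>i t. best_of ?S (?P i) t"], goal_cases)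
          case 1 show ?case by (simp add: best_of_def)
        next
          case 2 then show ?case using s3 by (simp add: round_state_def ready_def)
        next
          case (4 i t)
          have t: "round_state (s 1) t" "t 9 0 = i" "best_of ?S (?P i) t"
            using 4 s3 round_state_cong[of t ?s3 "s 1"] by simp_all
          have P: "?P (Suc i) = (if available I ?S i then ?P i \<union> {i} \<times> {0<..n} else ?P i)"
            by (auto simp: less_Suc_eq)
          have best_cell: "best_of S P (set_cell 9 0 x t') = best_of S P t'" for S P x t'
            by (rule best_of_cong) simp_all
          have tt: "t 0 = inp" "t 2 0 = n" "t 1 = s 1" using t by (simp_all add: round_state_def ready_def)
          show ?case
          proof (intro wp_Seq, rule wp_mono[OF wp_frame[OF wp_avail_com[of t, OF tt(1,2) t(2) \<open>i < n\<close>]]],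
              goal_cases)
            case (1 t1)
            then have fr: "\<And>a. a \<notin> {11, 23, 24} \<Longrightarrow> t1 a = t a" by auto
            have av: "eval_exp avail_exp t1 \<noteq> 0 \<longleftrightarrow> available I ?S i" using 1 tt by simp
            have t1: "round_state (s 1) t1" "t1 9 0 = i" "best_of ?S (?P i) t1"
              using t fr round_state_cong[of t1 t "s 1"] best_of_cong[of t1 t ?S "?P i"] by simp_all
            show ?case
            proof (intro wp_Cond[OF X2] wp_Skip, goal_cases)
              case 1
              then have "available I ?S i" using av by simp
              then show ?case
                unfolding best_cell using wp_walk_com[OF t1(1,2) \<open>i < n\<close> _ t1(3)] P by simp
            next
              case 2
              then show ?case unfolding best_cell using t1 av P by simp
            qed
          qed
        next
          case (5 t)
          have t: "round_state (s 1) t" "t 8 = s 8" "best_of ?S (?P n) t"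
            using 5 s3 round_state_cong[of t ?s3 "s 1"] by simp_all
          have "card ?S \<noteq> card {..<n}" using s(2,3) by simp
          then have "?S \<noteq> {..<n}" by metis
          then have "?S \<subset> ground I" using support_less ground by blast
          then obtain w where "available I ?S w" using exists_available_outside[OF wf forest] by blast
          then have "w < n" "(w, 1) \<in> ?P n" by (auto simp: available_def ground)
          then have "?P n \<noteq> {}" by blast
          then have B: "0 < t 18 0 \<and> t 18 0 \<le> n \<and> available I ?S (t 19 0) \<and>
              t 20 0 = scaled_coverage (?S \<union> walk I (t 19 0) (t 18 0)) \<and>
              t 21 0 = scaled_total (?S \<union> walk I (t 19 0) (t 18 0)) \<and>
              (\<forall>(v, k)\<in>?P n.
                (scaled_coverage (?S \<union> walk I v k) - scaled_coverage ?S) * (t 21 0 - scaled_total ?S)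
                \<le> (t 20 0 - scaled_coverage ?S) * (scaled_total (?S \<union> walk I v k) - scaled_total ?S))"
            using t(3) unfolding best_of_def by (elim disjE conjE) (simp_all only: simp_thms)
          have best: "0 < t 18 0" "t 18 0 \<le> n" "available I ?S (t 19 0)"
            "\<And>v k. available I ?S v \<Longrightarrow> 0 < k \<Longrightarrow> k \<le> n \<Longrightarrow>
              (scaled_coverage (?S \<union> walk I v k) - scaled_coverage ?S) *
                (scaled_total (?S \<union> walk I (t 19 0) (t 18 0)) - scaled_total ?S)
              \<le> (scaled_coverage (?S \<union> walk I (t 19 0) (t 18 0)) - scaled_coverage ?S) *
                (scaled_total (?S \<union> walk I v k) - scaled_total ?S)"
          proof -
            show "0 < t 18 0" "t 18 0 \<le> n" "available I ?S (t 19 0)" using B by simp_all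
            fix v k assume v: "available I ?S v" "0 < k" "k \<le> n"
            then have "(v, k) \<in> ?P n" by (simp add: available_def ground)
            then show "(scaled_coverage (?S \<union> walk I v k) - scaled_coverage ?S) *
                (scaled_total (?S \<union> walk I (t 19 0) (t 18 0)) - scaled_total ?S)
              \<le> (scaled_coverage (?S \<union> walk I (t 19 0) (t 18 0)) - scaled_coverage ?S) *
                (scaled_total (?S \<union> walk I v k) - scaled_total ?S)"
              using B by fastforce
          qed
          let ?A = "?S \<union> walk I (t 19 0) (t 18 0)"
          have un: "t 19 0 < n" "t 19 0 \<notin> ?S" using best(3) by (auto simp: available_def ground)
          have step: "greedy_step I ?S ?A"
            by (rule greedy_step_scaled[OF support_less un(1) best(4)])
          have ord: "partial_ordering I ?S (s 1)" using order by (simp add: greedy_ordering_def)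
          have "t 19 0 \<in> walk I (t 19 0) (t 18 0)"
            unfolding walk_def by (rule image_eqI[where x = 0]) (use best in auto)
          then have "?S \<subset> ?A" using un by auto
          moreover have "finite ?A"
            using walk_ground[OF wf forest, of "t 19 0" "t 18 0"] un support_less[of "s 1"]
            by (auto simp: ground intro: finite_subset)
          ultimately have card: "card ?S < card ?A" by (intro psubset_card_mono)
          have "wp N X append_com (\<lambda>t'. support (t' 1) = ?A \<and> partial_ordering I ?A (t' 1) \<and>
              t' 8 0 = card ?A \<and> (\<forall>v\<in>?S. t' 1 v = t 1 v)) t"
            by (rule wp_append_com) (use t s best ord in \<open>simp_all add: round_state_def\<close>)
          from wp_frame[OF this] show ?case
          proof (rule wp_mono, goal_cases)
            case (1 t')
            then have "ready t'" using t ready_cong[of t' t] by (simp add: round_state_def)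
            moreover have "greedy_ordering I ?A (t' 1)"
              by (rule greedy_ordering_extend[OF wf order step])
                (use 1 t in \<open>simp_all add: round_state_def\<close>)
            ultimately show ?case using 1 card s by simp
          qed
        qed simp
        then show ?case using ev by simp
      qed ((rule eval_Read_le, assumption) | simp)+
    qed
  qed
qed

lemma wp_main_com:
  assumes s: "s 0 = inp" "\<And>a i. a \<noteq> 0 \<Longrightarrow> s a i = 0"
  shows "wp N X main_com (\<lambda>t. greedy_ordering I (ground I) (t 1)) s"
proof (rule wp_cells_le)
  assume le: "cells_le X s"
  \<comment> \<open>\<open>N * Y \<le> X\<close> bounds \<open>Y\<close> itself only for positive
    \<open>N\<close>; the presence of a vertex, or below of a hyperedge, ensures this.\<close>
  have YX: "Y \<le> X" if "0 < n"
  proof -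
    have "1 * Y \<le> N * Y" using that sizes by (intro mult_le_mono1) simp
    then show ?thesis using sizes(7) by linarith
  qed
  have YX': "Y \<le> X" if "0 < m"
  proof -
    have "1 * Y \<le> N * Y" using that sizes by (intro mult_le_mono1) simp
    then show ?thesis using sizes(7) by linarith
  qed
  show ?thesis
    unfolding main_com_def
  proof (intro wp_Seq wp_Write[OF X2], goal_cases)
    case 3
    let ?s = "s(2 := (s 2)(0 := n), 3 := (s 3)(0 := m))"
    have "wp N X (scale_com (Const 2) (Const 2) (Scalar 2) 4)
      (\<lambda>s'. \<forall>v<n. s' 4 v = ?s 0 (2 + 2 * v) * (\<Prod>u\<in>{..<n} - {v}. ?s 0 (2 + 2 * u + 1))) ?s"
    proof (rule wp_scale_com[OF X2 nX], goal_cases)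
      case (3 v U)
      then show ?case
        using scaled_prod_le[of 2 U n v 2] cost_cell_disjoint s YX by simp
    qed simp_all
    then have "wp N X (scale_com (Const 2) (Const 2) (Scalar 2) 4) (\<lambda>s'. \<forall>v<n. s' 4 v = scaled_cost v) ?s"
      using s by (simp add: scaled_cost_def)
    from wp_frame[OF this]
    have "wp N X (scale_com (Const 2) (Const 2) (Scalar 2) 4)
      (wp N X (Seq (scale_com edge_base edge_stride (Scalar 3) 5)
        (Seq next_com (While (Sub (Scalar 2) (Scalar 8)) round_com)))
        (\<lambda>t. greedy_ordering I (ground I) (t 1))) ?s"
    proof (rule wp_mono, goal_cases)
      case (1 s1)
      then have fr1: "\<And>a. a \<notin> {9, 10, 4} \<Longrightarrow> s1 a = ?s a" by auto
      have "wp N X (scale_com edge_base edge_stride (Scalar 3) 5)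
        (\<lambda>s'. \<forall>j<m. s' 5 j = s1 0 (2 + 2 * n + n * n + (n + 2) * j) *
          (\<Prod>i\<in>{..<m} - {j}. s1 0 (2 + 2 * n + n * n + (n + 2) * i + 1))) s1"
      proof (rule wp_scale_com[OF X2 mX], goal_cases)
        case (2 s')
        then show ?case using fr1 by (simp add: edge_base_def edge_stride_def)
      next
        case (3 j U)
        have "s1 0 = inp" using fr1 s by simp
        moreover have "inp (2 + 2 * n + n * n + (n + 2) * j) *
           (\<Prod>i\<in>U. inp (2 + 2 * n + n * n + (n + 2) * i + 1)) \<le> Y"
          by (rule scaled_prod_le[of "n + 2" U m j]) (simp, rule 3(2), rule weight_cell_disjoint, simp)
        ultimately show ?case using YX' 3 by simp
      qed simp_all
      moreover have "s1 0 = inp" using fr1 s by simp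
      ultimately have "wp N X (scale_com edge_base edge_stride (Scalar 3) 5)
        (\<lambda>s'. \<forall>j<m. s' 5 j = scaled_weight j) s1"
        unfolding scaled_weight_def by simp
      from wp_frame[OF this] show ?case
      proof (rule wp_Seq[OF wp_mono], goal_cases)
        case (1 s2)
        then have fr2: "\<And>a. a \<notin> {9, 10, 4, 5} \<Longrightarrow> s2 a = ?s a" "s2 4 = s1 4" using fr1 by auto
        have c4: "\<forall>v<n. s2 4 v = scaled_cost v" using \<open>(\<forall>v<n. s1 4 v = scaled_cost v) \<and> _\<close> fr2 by simp
        have c5: "\<forall>j<m. s2 5 j = scaled_weight j" using 1 by simp
        have in2: "s2 0 = inp" "s2 2 0 = n" using fr2 s by simp_all
        from wp_frame[OF wp_next_com[OF in2]] show ?case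
        proof (rule wp_Seq[OF wp_mono], goal_cases)
          case (1 s3)
          then have fr3: "\<And>a. a \<notin> {9, 10, 4, 5, 6} \<Longrightarrow> s3 a = ?s a" "s3 4 = s2 4" "s3 5 = s2 5"
            using fr2 by auto
          have "ready s3" using 1 fr3 c4 c5 s by (simp add: ready_def)
          moreover have "support (s3 1) = {}" "s3 8 0 = 0" using fr3 s by (auto simp: support_def)
          ultimately have J: "ready s3 \<and> s3 8 0 = card (support (s3 1)) \<and>
              greedy_ordering I (support (s3 1)) (s3 1)"
            by (simp add: greedy_ordering_empty)
          show ?case
          proof (rule wp_While[OF X2, where f = "\<lambda>t. n - t 8 0" and J = "\<lambda>t. ready t \<and>
              t 8 0 = card (support (t 1)) \<and> greedy_ordering I (support (t 1)) (t 1)"], goal_cases)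
            case 1 show ?case by (rule J)
          next
            case 2 show ?case using nX by simp
          next
            case (3 t)
            then have "t 8 0 < n" by (simp add: ready_def)
            with 3 wp_round_com[of t] show ?case by (auto elim!: wp_mono)
          next
            case (4 t)
            then have "n \<le> card (support (t 1))" by (simp add: ready_def)
            then have "support (t 1) = ground I"
              using support_less[of "t 1"] card_subset_eq[of "{..<n}" "support (t 1)"]
                card_mono[of "{..<n}" "support (t 1)"] by (simp add: ground)
            then show ?case using 4 by simp
          qed
        qed
      qed
    qed
    then show ?case using s sizes by simp
  qed (use sizes s le in \<open>auto simp: cells_le_def\<close>)
qed

end

section \<open>The encoded input\<close>

lemma nth_concat_map_uniform:
  assumes "\<And>x. x \<in> set ls \<Longrightarrow> length (f x) = d" "i < length ls" "r < d"
  shows "concat (map f ls) ! (d * i + r) = f (ls ! i) ! r"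
  using assms
proof (induction ls arbitrary: i)
  case (Cons x ls)
  then show ?case by (cases i) (auto simp: nth_append)
qed simp

lemma length_concat_map_uniform:
  assumes "\<And>x. x \<in> set ls \<Longrightarrow> length (f x) = d"
  shows "length (concat (map f ls)) = d * length ls"
  using assms by (induction ls) auto

lemma encode_rat_fraction:
  assumes "0 \<le> q"
  shows "rat_of_nat (encode_rat q ! 0) = q * rat_of_nat (encode_rat q ! 1)" "0 < encode_rat q ! 1"
proof -
  obtain a b where ab: "quotient_of q = (a, b)" by fastforce
  have b: "0 < b" using quotient_of_denom_pos[OF ab] .
  have q: "q = of_int a / of_int b" using quotient_of_div[OF ab] .
  then have "0 \<le> a" using assms b by (simp add: zero_le_divide_iff)
  then show "rat_of_nat (encode_rat q ! 0) = q * rat_of_nat (encode_rat q ! 1)"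
    using ab b q by (simp add: encode_rat_def)
  show "0 < encode_rat q ! 1" using ab b by (simp add: encode_rat_def)
qed

lemma length_encode_rat [simp]: "length (encode_rat q) = 2"
  by (simp add: encode_rat_def)

lemma length_le_input_size: "length xs \<le> input_size xs"
  unfolding input_size_def using sum_list_mono[of xs "\<lambda>_. 1" bit_size] bit_size_pos
  by (simp add: Suc_le_eq sum_list_triv)

text \<open>A number is below 2 to its bit size, and the bit sizes of distinct cells add up to at
  most the input size; cells beyond the input hold 0. Multiplying all denominators therefore costs
  only linearly many bits.\<close>

lemma prod_initial_state_le:
  assumes "finite U"
  shows "(\<Prod>u\<in>U. initial_state xs 0 u) \<le> 2 ^ input_size xs"
proof -
  let ?b = "\<lambda>u. if u < length xs then bit_size (xs ! u) else 0"
  have "(\<Prod>u\<in>U. initial_state xs 0 u) \<le> (\<Prod>u\<in>U. 2 ^ ?b u)"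
    by (intro prod_mono) (use less_two_power_bit_size in \<open>auto simp: initial_state_def less_imp_le\<close>)
  also have "\<dots> = 2 ^ (\<Sum>u\<in>U. ?b u)" by (simp add: power_sum)
  also have "\<dots> \<le> 2 ^ input_size xs"
  proof (rule power_increasing)
    have "(\<Sum>u\<in>U. ?b u) = (\<Sum>u\<in>U \<inter> {..<length xs}. bit_size (xs ! u))"
      using assms by (simp add: sum.If_cases lessThan_def Int_def)
    also have "\<dots> \<le> (\<Sum>u<length xs. bit_size (xs ! u))" by (rule sum_mono2) auto
    also have "\<dots> = input_size xs"
      by (simp add: input_size_def sum_list_sum_nth atLeast0LessThan)
    finally show "(\<Sum>u\<in>U. ?b u) \<le> input_size xs" .
  qed simp
  finally show ?thesis .
qed

text \<open>The input size can serve as the bound on loop passes because the encoding spends at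
  least one cell on every vertex and every hyperedge, besides the two header cells, which make it at
  least 2.\<close>

lemma psc_input_encode:
  fixes xs :: "nat list"
  assumes wf: "psc_wf I" and forest: "inforest (ground I) (arcs I)"
    and ground: "ground I = {0..<n}" and es: "distinct es" "set es = hyperedges I"
    and xs: "xs = encode_psc I es"
  shows "psc_input I es (initial_state xs 0) n (length es) (input_size xs)
    (input_size xs * 2 ^ input_size xs) (2 ^ input_size xs)"
proof -
  define m where "m = length es"
  define N where "N = input_size xs"
  define A where "A = concat (map (\<lambda>v. encode_rat (elem_cost I v)) [0..<n])"
  define B where "B = concat (map (\<lambda>u. map (\<lambda>v. of_bool ((u, v) \<in> arcs I) :: nat) [0..<n]) [0..<n])"
  define C where "C = concat (map (\<lambda>e. encode_rat (weight I e) @ map (\<lambda>v. of_bool (v \<in> e)) [0..<n]) es)"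
  have xs': "xs = [n, m] @ A @ B @ C"
    unfolding xs encode_psc_def A_def B_def C_def m_def by (simp add: ground)
  have "length A = 2 * length [0..<n]" "length B = n * length [0..<n]" "length C = (n + 2) * length es"
    unfolding A_def B_def C_def by (rule length_concat_map_uniform, simp)+
  then have len: "length A = 2 * n" "length B = n * n" "length C = (n + 2) * m"
    by (simp_all add: m_def)
  have at_A: "initial_state xs 0 (2 + 2 * v + r) = encode_rat (elem_cost I v) ! r"
    if "v < n" "r < 2" for v r
  proof -
    have "2 * v + r < length A" using that len by simp
    then have "initial_state xs 0 (2 + 2 * v + r) = A ! (2 * v + r)"
      by (simp add: xs' initial_state_def nth_append)
    also have "\<dots> = encode_rat (elem_cost I v) ! r"
      unfolding A_def using that by (subst nth_concat_map_uniform) auto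
    finally show ?thesis .
  qed
  have at_B: "initial_state xs 0 (2 + 2 * n + (n * u + v)) = of_bool ((u, v) \<in> arcs I)"
    if "u < n" "v < n" for u v
  proof -
    have "n * u + v < n * Suc u" using that by simp
    also have "\<dots> \<le> n * n" using that by (intro mult_le_mono2) simp
    finally have "n * u + v < length B" using len by simp
    then have "initial_state xs 0 (2 + 2 * n + (n * u + v)) = B ! (n * u + v)"
      using len by (simp add: xs' initial_state_def nth_append)
    also have "\<dots> = of_bool ((u, v) \<in> arcs I)"
      unfolding B_def using that by (subst nth_concat_map_uniform) auto
    finally show ?thesis .
  qed
  have at_C: "initial_state xs 0 (2 + 2 * n + n * n + (n + 2) * j + r) =
      (encode_rat (weight I (es ! j)) @ map (\<lambda>v. of_bool (v \<in> es ! j)) [0..<n]) ! r"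
    if "j < m" "r < n + 2" for j r
  proof -
    have "(n + 2) * j + r < (n + 2) * Suc j" using that by simp
    also have "\<dots> \<le> (n + 2) * m" using that by (intro mult_le_mono2) simp
    finally have lt: "(n + 2) * j + r < length C" using len by simp
    have "initial_state xs 0 (2 + 2 * n + n * n + q) = C ! q" if "q < length C" for q
      using that len(1,2) by (simp add: xs' initial_state_def nth_append)
    then have "initial_state xs 0 (2 + 2 * n + n * n + ((n + 2) * j + r)) = C ! ((n + 2) * j + r)"
      using lt by blast
    also have "\<dots> = (encode_rat (weight I (es ! j)) @ map (\<lambda>v. of_bool (v \<in> es ! j)) [0..<n]) ! r"
      unfolding C_def using that by (subst nth_concat_map_uniform) (auto simp: m_def)
    finally show ?thesis by (simp add: add.assoc)
  qed
  have "n + m + 2 \<le> length xs" by (simp add: xs' len)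
  then have N: "n \<le> N" "m \<le> N" "2 \<le> N" using length_le_input_size[of xs] by (simp_all add: N_def)
  have NX: "N \<le> N * 2 ^ N" by simp
  have elem_nonneg: "0 \<le> elem_cost I v" if "v < n" for v
    using elem_cost_nonneg[OF wf, of v] that by (simp add: ground)
  have weight_nonneg': "0 \<le> weight I (es ! j)" if "j < m" for j
    using weight_nonneg[OF wf, of "es ! j"] that es nth_mem[of j es] by (simp add: m_def)
  show ?thesis
    unfolding m_def[symmetric] N_def[symmetric]
  proof (unfold_locales, goal_cases)
    case 3
    show ?case using ground by (simp add: atLeast0LessThan)
  next
    case 7
    show ?case by (simp add: xs' initial_state_def)
  next
    case 8
    show ?case by (simp add: xs' initial_state_def)
  next
    case 12
    show ?case using N NX by linarith
  next
    case (15 v)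
    then show ?case
      using at_A[of v 0] at_A[of v 1] encode_rat_fraction(1)[OF elem_nonneg] by simp
  next
    case (16 v)
    then show ?case using at_A[of v 1] encode_rat_fraction(2)[OF elem_nonneg] by simp
  next
    case (17 u v)
    then show ?case by (simp only: at_B) simp
  next
    case (18 j)
    then show ?case
      using at_C[of j 0] at_C[of j 1] encode_rat_fraction(1)[OF weight_nonneg'] by (simp add: nth_append)
  next
    case (19 j)
    then show ?case
      using at_C[of j 1] encode_rat_fraction(2)[OF weight_nonneg'] by (simp add: nth_append)
  next
    case (20 j v)
    then show ?case using at_C[of j "2 + v"] by (simp add: nth_append)
  next
    case (21 U)
    then show ?case unfolding N_def by (rule prod_initial_state_le)
  qed (use wf forest es N NX in \<open>simp_all add: m_def\<close>)
qed

section \<open>The approximation guarantee in polynomial time\<close>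

lemma main_com_correct:
  assumes "psc_wf I" "inforest (ground I) (arcs I)" "encodes xs I"
  shows "\<exists>t s. runs main_com (initial_state xs) t s \<and> feasible I (result s) \<and>
    objective I (result s) \<le> 4 * opt I \<and>
    t \<le> com_bound (input_size xs) main_com * (input_size xs + input_size xs)"
proof -
  define N where "N = input_size xs"
  define n where "n = card (ground I)"
  obtain es where es: "ground I = {0..<n}" "distinct es" "set es = hyperedges I" "xs = encode_psc I es"
    using assms(3) unfolding encodes_def n_def by auto
  interpret psc_input I es "initial_state xs 0" n "length es" N "N * 2 ^ N" "2 ^ N"
    unfolding N_def using psc_input_encode[OF assms(1,2) es] .
  have cell: "initial_state xs 0 i \<le> 2 ^ N" for i
    using prod_le[of "{i}"] by simp
  have N: "0 < N" using sizes(6) by (cases N) auto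
  have "(2::nat) ^ N \<le> N * 2 ^ N" using N by simp
  then have "initial_state xs a i \<le> N * 2 ^ N" for a i
    using cell[of i] by (cases "a = 0") (auto simp: initial_state_def intro: order_trans)
  then have le: "cells_le (N * 2 ^ N) (initial_state xs)" by (simp add: cells_le_def)
  have "wp N (N * 2 ^ N) main_com (\<lambda>t. greedy_ordering I (ground I) (t 1)) (initial_state xs)"
    by (rule wp_main_com) (auto simp: initial_state_def)
  then obtain t s where run: "runs main_com (initial_state xs) t s"
    "t \<le> com_bound N main_com * bit_size (N * 2 ^ N)" "greedy_ordering I (ground I) (s 1)"
    using le unfolding wp_def by blast
  \<comment> \<open>Cells bounded by \<open>N * 2 ^ N\<close> have at most \<open>2 * N\<close>
    bits, which is the factor \<open>N + N\<close> in the time bound.\<close>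
  have "N * 2 ^ N < 2 ^ N * 2 ^ N" using less_exp[of N] by simp
  then have "bit_size (N * 2 ^ N) \<le> N + N"
    using N by (intro bit_size_le) (simp_all add: power_add)
  then have "com_bound N main_com * bit_size (N * 2 ^ N) \<le> com_bound N main_com * (N + N)"
    by (rule mult_le_mono2)
  then have "t \<le> com_bound N main_com * (N + N)" using run(2) by linarith
  then show ?thesis
    using run greedy_ordering_4_approx[OF assms(1) run(3)] unfolding N_def result_def by blast
qed

theorem theorem5:
  shows "\<exists>P. approximation_algorithm P (\<lambda>I. inforest (ground I) (arcs I)) 4 \<and>
             polynomial_time P (\<lambda>I. inforest (ground I) (arcs I))"
proof (intro exI conjI)
  show "approximation_algorithm main_com (\<lambda>I. inforest (ground I) (arcs I)) 4"
    unfolding approximation_algorithm_def using main_com_correct by blast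
  have "poly_bounded (\<lambda>N. com_bound N main_com * (N + N))"
    by (intro poly_bounded_mult poly_bounded_add poly_bounded_com_bound poly_bounded_id)
  then obtain p :: "nat poly" where "\<And>N. com_bound N main_com * (N + N) \<le> poly p N"
    unfolding poly_bounded_def by blast
  then show "polynomial_time main_com (\<lambda>I. inforest (ground I) (arcs I))"
    unfolding polynomial_time_def using main_com_correct order_trans by meson
qed

end
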